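(* Let $\mathscr{G}$ be a separable Banach-Lie group and let $(\mathscr{F}^s_t)_{0\le s\le t<\infty}$ be an additive filtration satisfying the usual hypotheses on a complete probability space $(\Omega,\mathscr{F},\mathbb{P})$. Let $x=(x^s_t)_{0\le s\le t<\infty}$ be a $\mathscr{G}$-valued multiplicative process with respect to $(\mathscr{F}^s_t)_{s\le t}$. Then there exists a modification $\overline{x}=(\overline{x}^s_t)_{s\le t}$ of $x$ (i.e. $\mathbb{P}(\overline{x}^s_t=x^s_t)=1$ for all $s\le t$) such that: 1) $\overline{x}$ is càdlàg in both arguments (simultaneously); 2) $\overline{x}$ is a multiplicative process with respect to $(\mathscr{F}^s_t)_{s\le t}$; 3) for all $\omega\in\Omega$ and all $s\le t\le u$, $\overline{x}^s_s(\omega)=e$ and $\overline{x}^s_u(\omega)=\overline{x}^s_t(\omega)\,\overline{x}^t_u(\omega)$.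
   Context: A Banach-Lie group $\mathscr{G}$ is a group with identity $e$ that is also a Banach manifold (smooth in the Fréchet sense), with smooth multiplication and inversion. Random elements of $\mathscr{G}$ are Borel-measurable maps $\Omega\to\mathscr{G}$. An additive filtration is a family of $\sigma$-algebras $\mathscr{F}^s_t\subseteq\mathscr{F}$, $0\le s\le t<\infty$, such that for all $s\le t\le u\le v$: $\mathscr{F}^s_t$ and $\mathscr{F}^u_v$ are independent, and $\mathscr{F}^t_u\subseteq\mathscr{F}^s_v$. The usual hypotheses: for each fixed $s$, $(\mathscr{F}^s_t)_{t\ge s}$ is right-continuous in $t$, and every $\mathscr{F}^s_t$ is complete. A two-parameter process $x=(x^s_t)_{0\le s\le t<\infty}$ of random elements of $\mathscr{G}$ is a multiplicative process with respect to $(\mathscr{F}^s_t)_{s\le t}$ if: (1) $x^s_t$ is $\mathscr{F}^s_t$-measurable for all $s\le t$; (2) $x^s_s=e$ and $x^s_tx^t_u=x^s_u$ almost surely for all $s\le t\le u$; (3) $x$ is stochastically continuous, i.e. for all $s\le t$ and every open $U\subseteq\mathscr{G}$ containing $e$, $\lim_{h,k\to0}\mathbb{P}((x^s_t)^{-1}x^{s+h}_{t+k}\in U)=1$ (where $h,k$ may have any sign subject to $0\le s+h\le t+k$). Càdlàg in both arguments simultaneously: for every $\omega$, the map $(s,t)\mapsto x^s_t(\omega)$ on $\{0\le s\le t\}$ is jointly right-continuous (when $(s',t')\to(s,t)$ with $s'\ge s$, $t'\ge t$) and has joint limits when $(s',t')\to(s,t)$ within each of the regions obtained by requiring $s'\geq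 s$ or $s'<s$, and $t'\ge t$ or $t'<t$ (whenever $(s,t)$ is a limit point of that region intersected with $\{s'\le t'\}$). *)

theory Defs
  imports "HOL-Algebra.Group" "HOL-Probability.Probability"
begin

section \<open>Smooth maps between Banach spaces\<close>

text \<open>
  The iterated Frechet derivative of order \<open>n\<close> at \<open>x\<close> takes values in the space of bounded
  \<open>n\<close>-linear maps \<open>L\<^sup>n(E; F)\<close>, which is identified with \<open>L(E, L\<^sup>n\<^sup>-\<^sup>1(E; F))\<close> in the usual way.
  As this space depends on \<open>n\<close>, an \<open>n\<close>-linear map is represented as a function on lists, of which
  only the values on lists of length \<open>n\<close> matter.
\<close>

definition bounded_multilinear ::
    "nat \<Rightarrow> ('a::real_normed_vector list \<Rightarrow> 'b::real_normed_vector) \<Rightarrow> bool" where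
  "bounded_multilinear n m \<longleftrightarrow>
     (\<forall>vs i. length vs = n \<longrightarrow> i < n \<longrightarrow> linear (\<lambda>v. m (vs[i := v]))) \<and>
     (\<exists>K. \<forall>vs. length vs = n \<longrightarrow> norm (m vs) \<le> K * prod_list (map norm vs))"

text \<open>
  \<open>D' x\<close>, as the linear map \<open>h \<mapsto> (vs \<mapsto> D' x (h # vs))\<close>, is the Frechet derivative at \<open>x\<close> of the
  map \<open>D\<close> into \<open>L\<^sup>n(E; F)\<close>, where the latter carries the operator norm: the remainder is at most
  \<open>e * norm (y - x)\<close> in that norm.
\<close>

definition has_multilinear_derivative_at ::
    "nat \<Rightarrow> ('a::real_normed_vector \<Rightarrow> 'a list \<Rightarrow> 'b::real_normed_vector)
      \<Rightarrow> ('a \<Rightarrow> 'a list \<Rightarrow> 'b) \<Rightarrow> 'a \<Rightarrow> bool" where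
  "has_multilinear_derivative_at n D D' x \<longleftrightarrow>
     (\<forall>e>0. \<forall>\<^sub>F y in nhds x. \<forall>vs. length vs = n \<longrightarrow>
        norm (D y vs - D x vs - D' x ((y - x) # vs))
          \<le> e * norm (y - x) * prod_list (map norm vs))"

definition smooth_on ::
    "'a::real_normed_vector set \<Rightarrow> ('a \<Rightarrow> 'b::real_normed_vector) \<Rightarrow> bool" where
  "smooth_on S f \<longleftrightarrow> open S \<and>
     (\<exists>D :: nat \<Rightarrow> 'a \<Rightarrow> 'a list \<Rightarrow> 'b.
        (\<forall>x\<in>S. D 0 x [] = f x) \<and>
        (\<forall>n. \<forall>x\<in>S. bounded_multilinear n (D n x)) \<and>
        (\<forall>n. \<forall>x\<in>S. has_multilinear_derivative_at n (D n) (D (Suc n)) x))"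


section \<open>Banach manifolds and Banach-Lie groups\<close>

text \<open>
  A chart is a pair \<open>(U, \<phi>)\<close> of an open set and a homeomorphism of it onto an open subset of the
  model space.  The values of \<open>\<phi>\<close> outside \<open>U\<close> are irrelevant.
\<close>

type_synonym ('m, 'e) chart = "'m set \<times> ('m \<Rightarrow> 'e)"

definition is_chart :: "('m::topological_space, 'e::real_normed_vector) chart \<Rightarrow> bool" where
  "is_chart c \<longleftrightarrow> (case c of (U, \<phi>) \<Rightarrow>
     open U \<and> open (\<phi> ` U) \<and> homeomorphism U (\<phi> ` U) \<phi> (inv_into U \<phi>))"

definition smooth_atlas :: "('m::topological_space, 'e::banach) chart set \<Rightarrow> bool" where
  "smooth_atlas A \<longleftrightarrow>
     (\<forall>c\<in>A. is_chart c) \<and>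
     (\<Union>(U, \<phi>)\<in>A. U) = UNIV \<and>
     (\<forall>(U, \<phi>)\<in>A. \<forall>(V, \<psi>)\<in>A. smooth_on (\<phi> ` (U \<inter> V)) (\<psi> \<circ> inv_into U \<phi>))"

definition smooth_map ::
    "('m::topological_space, 'e::banach) chart set \<Rightarrow> ('n::topological_space, 'f::banach) chart set
      \<Rightarrow> ('m \<Rightarrow> 'n) \<Rightarrow> bool" where
  "smooth_map A B f \<longleftrightarrow>
     continuous_on UNIV f \<and>
     (\<forall>(U, \<phi>)\<in>A. \<forall>(V, \<psi>)\<in>B. smooth_on (\<phi> ` (U \<inter> f -` V)) (\<psi> \<circ> f \<circ> inv_into U \<phi>))"

definition prod_atlas ::
    "('m, 'e) chart set \<Rightarrow> ('n, 'f) chart set \<Rightarrow> ('m \<times> 'n, 'e \<times> 'f) chart set" where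
  "prod_atlas A B = {(U \<times> V, map_prod \<phi> \<psi>) | U \<phi> V \<psi>. (U, \<phi>) \<in> A \<and> (V, \<psi>) \<in> B}"

text \<open>
  The group lives on a whole type, whose topology is the manifold topology.  One model space
  suffices since left translations are diffeomorphisms.  The Hausdorff property is not required
  separately: it follows, since the topology is locally that of a Banach space and makes the
  group operations continuous.
\<close>

locale banach_lie_group = group G
  for G :: "('g::topological_space, 'z) monoid_scheme" (structure) +
  fixes A :: "('g, 'e::banach) chart set"
  assumes carrier_UNIV: "carrier G = UNIV"
    and atlas: "smooth_atlas A"
    and smooth_mult: "smooth_map (prod_atlas A A) A (\<lambda>(a, b). a \<otimes> b)"
    and smooth_inv: "smooth_map A A (\<lambda>a. inv a)"


section \<open>Additive filtrations\<close>

text \<open>Only the values \<open>F s t\<close> for \<open>0 \<le> s \<le> t\<close> matter.\<close>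

locale additive_filtration = prob_space M
  for M :: "'w measure" +
  fixes F :: "real \<Rightarrow> real \<Rightarrow> 'w measure"
  assumes subalg: "\<And>s t. 0 \<le> s \<Longrightarrow> s \<le> t \<Longrightarrow> subalgebra M (F s t)"
    and indep: "\<And>s t u v. 0 \<le> s \<Longrightarrow> s \<le> t \<Longrightarrow> t \<le> u \<Longrightarrow> u \<le> v \<Longrightarrow>
                  indep_set (sets (F s t)) (sets (F u v))"
    and mono: "\<And>s t u v. 0 \<le> s \<Longrightarrow> s \<le> t \<Longrightarrow> t \<le> u \<Longrightarrow> u \<le> v \<Longrightarrow>
                  sets (F t u) \<subseteq> sets (F s v)"

text \<open>
  Completeness of \<open>F s t\<close> is meant as usual for filtrations: it contains all null sets of the
  underlying (complete) probability space.
\<close>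

definition usual_hypotheses :: "'w measure \<Rightarrow> (real \<Rightarrow> real \<Rightarrow> 'w measure) \<Rightarrow> bool" where
  "usual_hypotheses M F \<longleftrightarrow>
     (\<forall>s t. 0 \<le> s \<longrightarrow> s \<le> t \<longrightarrow>
        (\<Inter>u\<in>{t<..}. sets (F s u)) = sets (F s t) \<and> null_sets M \<subseteq> sets (F s t))"


section \<open>Multiplicative processes\<close>

definition stochastically_continuous ::
    "('g::topological_space, 'z) monoid_scheme \<Rightarrow> 'w measure \<Rightarrow> (real \<Rightarrow> real \<Rightarrow> 'w \<Rightarrow> 'g) \<Rightarrow> bool" where
  "stochastically_continuous G M x \<longleftrightarrow>
     (\<forall>s t U. 0 \<le> s \<longrightarrow> s \<le> t \<longrightarrow> open U \<longrightarrow> \<one>\<^bsub>G\<^esub> \<in> U \<longrightarrow>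
        ((\<lambda>(h, k). measure M {\<omega> \<in> space M. inv\<^bsub>G\<^esub> (x s t \<omega>) \<otimes>\<^bsub>G\<^esub> x (s + h) (t + k) \<omega> \<in> U})
          \<longlongrightarrow> 1) (at (0, 0) within {(h, k). 0 \<le> s + h \<and> s + h \<le> t + k}))"

definition multiplicative_process ::
    "('g::topological_space, 'z) monoid_scheme \<Rightarrow> 'w measure \<Rightarrow> (real \<Rightarrow> real \<Rightarrow> 'w measure)
      \<Rightarrow> (real \<Rightarrow> real \<Rightarrow> 'w \<Rightarrow> 'g) \<Rightarrow> bool" where
  "multiplicative_process G M F x \<longleftrightarrow>
     (\<forall>s t. 0 \<le> s \<longrightarrow> s \<le> t \<longrightarrow> x s t \<in> F s t \<rightarrow>\<^sub>M borel) \<and>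
     (\<forall>s. 0 \<le> s \<longrightarrow> (AE \<omega> in M. x s s \<omega> = \<one>\<^bsub>G\<^esub>)) \<and>
     (\<forall>s t u. 0 \<le> s \<longrightarrow> s \<le> t \<longrightarrow> t \<le> u \<longrightarrow>
        (AE \<omega> in M. x s t \<omega> \<otimes>\<^bsub>G\<^esub> x t u \<omega> = x s u \<omega>)) \<and>
     stochastically_continuous G M x"

definition modification ::
    "'w measure \<Rightarrow> (real \<Rightarrow> real \<Rightarrow> 'w \<Rightarrow> 'g) \<Rightarrow> (real \<Rightarrow> real \<Rightarrow> 'w \<Rightarrow> 'g) \<Rightarrow> bool" where
  "modification M y x \<longleftrightarrow> (\<forall>s t. 0 \<le> s \<longrightarrow> s \<le> t \<longrightarrow> (AE \<omega> in M. y s t \<omega> = x s t \<omega>))"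

definition time_simplex :: "(real \<times> real) set" where
  "time_simplex = {(s, t). 0 \<le> s \<and> s \<le> t}"

definition cadlag_both :: "(real \<Rightarrow> real \<Rightarrow> 'g::topological_space) \<Rightarrow> bool" where
  "cadlag_both f \<longleftrightarrow>
     (\<forall>(s, t)\<in>time_simplex.
        ((\<lambda>(s', t'). f s' t') \<longlongrightarrow> f s t) (at (s, t) within time_simplex \<inter> {s..} \<times> {t..}) \<and>
        (\<forall>I\<in>{{s..}, {..<s}}. \<forall>J\<in>{{t..}, {..<t}}. (s, t) islimpt time_simplex \<inter> I \<times> J \<longrightarrow>
           (\<exists>l. ((\<lambda>(s', t'). f s' t') \<longlongrightarrow> l) (at (s, t) within time_simplex \<inter> I \<times> J))))"

end

theory Submission
  imports Defs
begin

text \<open>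
  Put \<open>X t = x 0 t\<close>; then \<open>x s t = inv (X s) \<otimes> X t\<close> almost surely, so it suffices to find a
  cadlag modification of \<open>X\<close> and to define \<open>y\<close> by this formula for every \<open>\<omega>\<close>.  A short time interval
  carries few large increments: Ottaviani's inequality bounds by one half the probability that the
  process leaves a given neighbourhood of \<open>\<one>\<close>, and by independence the probability of \<open>p\<close> successive
  exits is at most \<open>(1 / 2) ^ p\<close>.  Hence almost surely the restriction of \<open>X\<close> to the rationals is
  left Cauchy on both sides of every time.  One-sided limits exist because the multiplication is
  locally Lipschitz in a chart, which makes the group complete for its left uniformity.
\<close>

section \<open>Topological groups and left completeness\<close>

text \<open>The cocycle identity holds almost surely for each fixed triple of times, so it can be
  used for only countably many triples at once; hence the detour through rational times. The
  increment over \<open>[u, v]\<close> is the left quotient \<open>inv (X u) \<otimes> X v\<close>,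
  so closeness is measured by left quotients lying in a neighbourhood of \<open>\<one>\<close>, and
  no metric on the group enters. Neighbourhoods shrink twice: right quotients of \<open>V\<close>
  lie in \<open>N\<close>, for Ottaviani's inequality, and left quotients of \<open>N\<close> lie in
  \<open>W\<close>, so that an oscillation beyond \<open>W\<close> forces an exit from
  \<open>N\<close>. If every increment leaves \<open>V\<close> with probability at most 1/3, an exit
  from \<open>N\<close> has probability at most (1/3) / (2/3) = 1/2. Stochastic continuity gives the
  bound 1/3 only near each time; the intervals with rational endpoints on which it holds are
  countable and cover the half-line, so one null set serves all real times.\<close>

lemma smooth_on_locally_lipschitz:
  assumes "smooth_on S f" "x \<in> S"
  obtains d C where "d > 0" "ball x d \<subseteq> S"
    "\<And>y z. y \<in> ball x d \<Longrightarrow> z \<in> ball x d \<Longrightarrow> norm (f y - f z) \<le> C * norm (y - z)"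
proof -
  from assms obtain D where S: "open S" and D0: "\<And>y. y \<in> S \<Longrightarrow> D 0 y [] = f y"
    and D1: "\<And>n y. y \<in> S \<Longrightarrow> bounded_multilinear n (D n y)"
    and D2: "\<And>n y. y \<in> S \<Longrightarrow> has_multilinear_derivative_at n (D n) (D (Suc n)) y"
    unfolding smooth_on_def by blast
  have lin: "linear (\<lambda>v. D 1 y [v])" if "y \<in> S" for y
  proof -
    have "\<forall>vs i. length vs = 1 \<longrightarrow> i < 1 \<longrightarrow> linear (\<lambda>v. D 1 y (vs[i := v]))"
      using D1[OF that, of 1] unfolding bounded_multilinear_def by simp
    from this[rule_format, of "[0]" 0] show ?thesis by simp
  qed
  have bd1: "\<exists>K. \<forall>v. norm (D 1 y [v]) \<le> K * norm v" if "y \<in> S" for y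
  proof -
    from D1[OF that, of 1] obtain K
      where "\<forall>vs. length vs = 1 \<longrightarrow> norm (D 1 y vs) \<le> K * prod_list (map norm vs)"
      unfolding bounded_multilinear_def by blast
    from this[rule_format, of "[v]" for v] show ?thesis by auto
  qed
  have der: "(f has_derivative (\<lambda>v. D 1 y [v])) (at y)" if y: "y \<in> S" for y
    unfolding has_derivative_at_alt
  proof (intro conjI allI impI)
    show "bounded_linear (\<lambda>v. D 1 y [v])"
      using lin[OF y] bd1[OF y] unfolding bounded_linear_def bounded_linear_axioms_def
      by (metis mult.commute)
    fix e :: real assume "e > 0"
    with D2[OF y, of 0] have "\<forall>\<^sub>F z in nhds y. norm (D 0 z [] - D 0 y [] - D 1 y [z - y]) \<le> e * norm (z - y)"
      unfolding has_multilinear_derivative_at_def by simp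
    moreover have "\<forall>\<^sub>F z in nhds y. z \<in> S" using S y by (rule eventually_nhds_in_open)
    ultimately have "\<forall>\<^sub>F z in nhds y. norm (f z - f y - D 1 y [z - y]) \<le> e * norm (z - y)"
      by eventually_elim (simp add: D0 y)
    then show "\<exists>d>0. \<forall>z. norm (z - y) < d \<longrightarrow> norm (f z - f y - D 1 y [z - y]) \<le> e * norm (z - y)"
      unfolding eventually_nhds_metric dist_norm .
  qed
  obtain K1 where K1: "\<And>v. norm (D 1 x [v]) \<le> K1 * norm v" using bd1 assms(2) by blast
  obtain K2 where K2: "\<And>u v. norm (D 2 x [u, v]) \<le> K2 * (norm u * norm v)"
  proof -
    from D1[OF assms(2), of 2] obtain K
      where "\<forall>vs. length vs = 2 \<longrightarrow> norm (D 2 x vs) \<le> K * prod_list (map norm vs)"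
      unfolding bounded_multilinear_def by blast
    from this[rule_format, of "[u, v]" for u v] that show ?thesis by auto
  qed
  \<comment> \<open>Taking \<open>e = 1\<close> suffices: differentiability of the first derivative
    in operator norm makes it bounded near \<open>x\<close>, and the mean value inequality on a ball
    turns that bound into a Lipschitz constant.\<close>
  have "\<forall>\<^sub>F y in nhds x. \<forall>v. norm (D 1 y [v] - D 1 x [v] - D 2 x [y - x, v]) \<le> norm (y - x) * norm v"
    using D2[OF assms(2), of 1] unfolding has_multilinear_derivative_at_def
  proof (elim allE[of _ "1::real"] impE)
    assume "\<forall>\<^sub>F y in nhds x. \<forall>vs. length vs = 1 \<longrightarrow>
      norm (D 1 y vs - D 1 x vs - D (Suc 1) x ((y - x) # vs)) \<le> 1 * norm (y - x) * prod_list (map norm vs)"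
    then show ?thesis
      by eventually_elim (auto simp: numeral_2_eq_2 dest: spec[of _ "[v]" for v])
  qed simp
  moreover have "\<forall>\<^sub>F y in nhds x. y \<in> S" using S assms(2) by (rule eventually_nhds_in_open)
  ultimately have "\<forall>\<^sub>F y in nhds x. y \<in> S \<and>
      (\<forall>v. norm (D 1 y [v] - D 1 x [v] - D 2 x [y - x, v]) \<le> norm (y - x) * norm v)"
    by eventually_elim auto
  then obtain d' where d': "d' > 0" "\<And>y. dist y x < d' \<Longrightarrow> y \<in> S"
      "\<And>y v. dist y x < d' \<Longrightarrow> norm (D 1 y [v] - D 1 x [v] - D 2 x [y - x, v]) \<le> norm (y - x) * norm v"
    unfolding eventually_nhds_metric by blast
  define d where "d = min d' 1"
  have d: "d > 0" "d \<le> d'" "d \<le> 1" using d' by (auto simp: d_def)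
  \<comment> \<open>The summands account for \<open>D 1 x\<close>, for
    \<open>D 2 x [y - x, v]\<close> and for the remainder; the last two use
    \<open>norm (y - x) \<le> 1\<close>, which is why \<open>d\<close> is capped at 1.\<close>
  define C where "C = \<bar>K1\<bar> + \<bar>K2\<bar> + 1"
  have C0: "C \<ge> 0" by (simp add: C_def)
  have bound: "norm (D 1 y [v]) \<le> C * norm v" if y: "y \<in> ball x d" for y v
  proof -
    have n: "norm (y - x) \<le> 1" "dist y x < d'" using y d by (auto simp: dist_norm norm_minus_commute)
    have "norm (D 1 y [v]) \<le> norm (D 1 y [v] - D 1 x [v] - D 2 x [y - x, v]) + norm (D 1 x [v]) + norm (D 2 x [y - x, v])"
      using norm_triangle_ineq[of "D 1 y [v] - D 1 x [v] - D 2 x [y - x, v]" "D 1 x [v] + D 2 x [y - x, v]"]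
        norm_triangle_ineq[of "D 1 x [v]" "D 2 x [y - x, v]"] by (simp add: algebra_simps)
    moreover have "norm (D 1 y [v] - D 1 x [v] - D 2 x [y - x, v]) \<le> 1 * norm v"
      using d'(3)[OF n(2), of v] mult_right_mono[OF n(1), of "norm v"] by simp
    moreover have "norm (D 2 x [y - x, v]) \<le> \<bar>K2\<bar> * norm v"
    proof -
      have "norm (D 2 x [y - x, v]) \<le> K2 * (norm (y - x) * norm v)" by (rule K2)
      also have "\<dots> \<le> \<bar>K2\<bar> * (1 * norm v)"
        using n(1) by (intro mult_mono) auto
      finally show ?thesis by simp
    qed
    moreover have "norm (D 1 x [v]) \<le> \<bar>K1\<bar> * norm v"
      using K1[of v] mult_right_mono[OF abs_ge_self[of K1], of "norm v"] by simp
    ultimately show ?thesis by (simp add: C_def algebra_simps)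
  qed
  have sub: "ball x d \<subseteq> S" using d' d by (auto simp: dist_commute)
  have "norm (f y - f z) \<le> C * norm (y - z)" if yz: "y \<in> ball x d" "z \<in> ball x d" for y z
  proof (rule differentiable_bound[of "ball x d" f "\<lambda>y v. D 1 y [v]" C])
    show "convex (ball x d)" by (rule convex_ball)
    show "(f has_derivative (\<lambda>v. D 1 w [v])) (at w within ball x d)" if "w \<in> ball x d" for w
      by (rule has_derivative_at_withinI, rule der, rule subsetD[OF sub that])
    show "onorm (\<lambda>v. D 1 w [v]) \<le> C" if "w \<in> ball x d" for w
      by (rule onorm_bound) (use bound[OF that] C0 in auto)
  qed (rule yz)+
  then show ?thesis using that[OF d(1) sub] by blast
qed

section \<open>Neighbourhoods of the identity and quotients\<close>

locale topological_group = group G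
  for G :: "('g::topological_space, 'z) monoid_scheme" (structure) +
  assumes carrier_UNIV [simp]: "carrier G = UNIV"
    and continuous_mult: "continuous_on UNIV (\<lambda>(a, b). a \<otimes> b)"
    and continuous_inv: "continuous_on UNIV (\<lambda>a. inv a)"
begin

lemma m_cancel [simp]: "inv a \<otimes> (a \<otimes> b) = b" "a \<otimes> (inv a \<otimes> b) = b"
  using m_assoc[symmetric] by simp_all

lemma inv_mult: "inv (a \<otimes> b) = inv b \<otimes> inv a"
  by (simp add: inv_mult_group)

lemma assoc: "(a \<otimes> b) \<otimes> c = a \<otimes> (b \<otimes> c)"
  by (simp add: m_assoc)

lemma tendsto_mult:
  assumes "(f \<longlongrightarrow> a) F" "(g \<longlongrightarrow> b) F"
  shows "((\<lambda>x. f x \<otimes> g x) \<longlongrightarrow> a \<otimes> b) F"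
  using continuous_on_tendsto_compose[OF continuous_mult tendsto_Pair[OF assms]] by simp

lemma tendsto_inv:
  assumes "(f \<longlongrightarrow> a) F"
  shows "((\<lambda>x. inv (f x)) \<longlongrightarrow> inv a) F"
  using continuous_on_tendsto_compose[OF continuous_inv assms] by simp

text \<open>Continuity of right division at \<open>(\<one>, \<one>)\<close>. Right quotients arise
  when a common last factor is cancelled: \<open>x s j\<close> is \<open>x s b\<close> times the
  inverse of \<open>x j b\<close>.\<close>

lemma nhd_one_rdiv:
  assumes "open N" "\<one> \<in> N"
  shows "\<exists>V. open V \<and> \<one> \<in> V \<and> (\<forall>a\<in>V. \<forall>b\<in>V. a \<otimes> inv b \<in> N)"
proof -
  have "((\<lambda>p. fst p \<otimes> inv (snd p)) \<longlongrightarrow> \<one> \<otimes> inv \<one>) (nhds (\<one>, \<one>))"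
    by (intro tendsto_mult tendsto_inv) (auto simp: nhds_prod filterlim_fst filterlim_snd)
  then have "\<forall>\<^sub>F p in nhds (\<one>, \<one>). fst p \<otimes> inv (snd p) \<in> N"
    using assms by (auto dest: topological_tendstoD)
  then obtain S where S: "open S" "(\<one>, \<one>) \<in> S" "\<forall>p\<in>S. fst p \<otimes> inv (snd p) \<in> N"
    unfolding eventually_nhds by blast
  obtain P Q where PQ: "open P" "open Q" "(\<one>, \<one>) \<in> P \<times> Q" "P \<times> Q \<subseteq> S"
    by (rule open_prod_elim[OF S(1,2)])
  have "open (P \<inter> Q)" "\<one> \<in> P \<inter> Q" using PQ by auto
  moreover have "a \<otimes> inv b \<in> N" if "a \<in> P \<inter> Q" "b \<in> P \<inter> Q" for a b
    using bspec[OF S(3), of "(a, b)"] PQ(4) that by auto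
  ultimately show ?thesis by blast
qed

lemma nhd_one_inv:
  assumes "open N" "\<one> \<in> N"
  shows "\<exists>V. open V \<and> \<one> \<in> V \<and> V \<subseteq> N \<and> (\<forall>a\<in>V. inv a \<in> N)"
proof -
  obtain V where V: "open V" "\<one> \<in> V" "\<forall>a\<in>V. \<forall>b\<in>V. a \<otimes> inv b \<in> N"
    using nhd_one_rdiv[OF assms] by blast
  have "V \<subseteq> N" using V(2,3) by fastforce
  moreover have "\<forall>a\<in>V. inv a \<in> N" using V(2,3) by fastforce
  ultimately show ?thesis using V by blast
qed

text \<open>The right-division version, applied to \<open>inv a\<close> and
  \<open>inv b\<close>.\<close>

lemma nhd_one_ldiv:
  assumes "open N" "\<one> \<in> N"
  shows "\<exists>V. open V \<and> \<one> \<in> V \<and> (\<forall>a\<in>V. \<forall>b\<in>V. inv a \<otimes> b \<in> N)"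
proof -
  obtain V where V: "open V" "\<one> \<in> V" "\<forall>a\<in>V. \<forall>b\<in>V. a \<otimes> inv b \<in> N"
    using nhd_one_rdiv[OF assms] by blast
  obtain V' where V': "open V'" "\<one> \<in> V'" "V' \<subseteq> V" "\<forall>a\<in>V'. inv a \<in> V"
    using nhd_one_inv[OF V(1,2)] by blast
  have "inv a \<otimes> b \<in> N" if "a \<in> V'" "b \<in> V'" for a b
    using V(3) V'(4) that by fastforce
  then show ?thesis using V' by blast
qed

text \<open>Left translation by \<open>l\<close> is a homeomorphism, so the neighbourhoods of
  \<open>l\<close> are the translates of those of \<open>\<one>\<close>.\<close>

lemma tendsto_iff_ldiv:
  "(f \<longlongrightarrow> l) F \<longleftrightarrow> (\<forall>N. open N \<longrightarrow> \<one> \<in> N \<longrightarrow> (\<forall>\<^sub>F x in F. inv l \<otimes> f x \<in> N))"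
proof
  assume "(f \<longlongrightarrow> l) F"
  then have "((\<lambda>x. inv l \<otimes> f x) \<longlongrightarrow> inv l \<otimes> l) F" by (intro tendsto_mult tendsto_const)
  then have "((\<lambda>x. inv l \<otimes> f x) \<longlongrightarrow> \<one>) F" by simp
  then show "\<forall>N. open N \<longrightarrow> \<one> \<in> N \<longrightarrow> (\<forall>\<^sub>F x in F. inv l \<otimes> f x \<in> N)"
    unfolding tendsto_def .
next
  assume "\<forall>N. open N \<longrightarrow> \<one> \<in> N \<longrightarrow> (\<forall>\<^sub>F x in F. inv l \<otimes> f x \<in> N)"
  then have "((\<lambda>x. inv l \<otimes> f x) \<longlongrightarrow> \<one>) F" unfolding tendsto_def .
  then have "((\<lambda>x. l \<otimes> (inv l \<otimes> f x)) \<longlongrightarrow> l \<otimes> \<one>) F" by (intro tendsto_mult tendsto_const)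
  then show "(f \<longlongrightarrow> l) F" by simp
qed

end

text \<open>Beyond continuity of the operations, this is all that the probabilistic argument takes
  from the manifold. \<open>left_complete\<close> says that every filter that is Cauchy for the left
  uniformity converges; \<open>separated\<close> makes limits unique; \<open>countable_basis\<close>
  reduces conditions on all neighbourhoods of \<open>\<one>\<close> to countably many, hence to one
  null set.\<close>

locale left_complete_group = topological_group G
  for G :: "('g::topological_space, 'z) monoid_scheme" (structure) +
  assumes separated: "z \<noteq> \<one> \<Longrightarrow> \<exists>N. open N \<and> \<one> \<in> N \<and> z \<notin> N"
    and countable_basis: "\<exists>W :: nat \<Rightarrow> 'g set.
        (\<forall>n. open (W n) \<and> \<one> \<in> W n) \<and> (\<forall>N. open N \<longrightarrow> \<one> \<in> N \<longrightarrow> (\<forall>\<^sub>F n in sequentially. W n \<subseteq> N))"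
    and left_complete: "F \<noteq> bot \<Longrightarrow>
        (\<And>N. open N \<Longrightarrow> \<one> \<in> N \<Longrightarrow> \<exists>P. eventually P F \<and> (\<forall>a b. P a \<longrightarrow> P b \<longrightarrow> inv a \<otimes> b \<in> N)) \<Longrightarrow>
        \<exists>l. F \<le> nhds l"
begin

text \<open>The type is only a \<open>topological_space\<close>, so uniqueness is derived from
  \<open>separated\<close>: the common factor \<open>f x\<close> cancels, which makes
  \<open>inv b \<otimes> a\<close> a right quotient of two elements of \<open>V\<close>.\<close>

lemma limit_unique:
  fixes f :: "'x \<Rightarrow> 'g"
  assumes "F \<noteq> bot" "(f \<longlongrightarrow> a) F" "(f \<longlongrightarrow> b) F"
  shows "a = b"
proof (rule ccontr)
  assume "a \<noteq> b"
  then have "inv b \<otimes> a \<noteq> \<one>" by (metis UNIV_I carrier_UNIV m_cancel(2) r_one)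
  then obtain N where N: "open N" "\<one> \<in> N" "inv b \<otimes> a \<notin> N" using separated by blast
  obtain V where V: "open V" "\<one> \<in> V" "\<forall>a\<in>V. \<forall>b\<in>V. a \<otimes> inv b \<in> N"
    using nhd_one_rdiv[OF N(1,2)] by blast
  have "\<forall>\<^sub>F x in F. inv a \<otimes> f x \<in> V" "\<forall>\<^sub>F x in F. inv b \<otimes> f x \<in> V"
    using assms V unfolding tendsto_iff_ldiv by auto
  then have "\<forall>\<^sub>F x in F. False"
  proof eventually_elim
    case (elim x)
    have "(inv b \<otimes> f x) \<otimes> inv (inv a \<otimes> f x) = inv b \<otimes> a"
      by (simp add: inv_mult assoc)
    with V(3) elim N(3) show False by metis
  qed
  with assms(1) show False by simp
qed

end

section \<open>Left completeness of Banach-Lie groups\<close>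

context banach_lie_group
begin

lemma topological_group: "topological_group G"
proof
  show "continuous_on UNIV (\<lambda>(a, b). a \<otimes> b)" "continuous_on UNIV (\<lambda>a. inv a)"
    using smooth_mult smooth_inv unfolding smooth_map_def by blast+
qed (rule carrier_UNIV)

lemma left_complete_group: "left_complete_group G"
proof -
  interpret topological_group G by (rule topological_group)
  obtain U \<phi> where UA: "(U, \<phi>) \<in> A" and eU: "\<one> \<in> U"
    using atlas unfolding smooth_atlas_def by blast
  have "is_chart (U, \<phi>)" using atlas UA unfolding smooth_atlas_def by blast
  then have U: "open U" and oU: "open (\<phi> ` U)" and hom: "homeomorphism U (\<phi> ` U) \<phi> (inv_into U \<phi>)"
    unfolding is_chart_def by auto
  define \<psi> where "\<psi> = inv_into U \<phi>"
  have \<psi>\<phi> [simp]: "\<psi> (\<phi> a) = a" if "a \<in> U" for a using hom that unfolding \<psi>_def homeomorphism_def by blast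
  have \<phi>\<psi> [simp]: "\<phi> (\<psi> u) = u" if "u \<in> \<phi> ` U" for u using that by auto
  have cont\<phi>: "continuous_on U \<phi>" and cont\<psi>: "continuous_on (\<phi> ` U) \<psi>"
    using hom unfolding \<psi>_def homeomorphism_def by auto
  have nhd: "\<exists>N. open N \<and> \<one> \<in> N \<and> N \<subseteq> U \<and> (\<forall>a\<in>N. \<phi> a \<in> B)" if "open B" "\<phi> \<one> \<in> B" for B
    using continuous_openin_preimage_gen[OF cont\<phi> that(1)] U that(2) eU
    by (intro exI[of _ "U \<inter> \<phi> -` B"]) (auto simp: openin_open_eq)
  have nhd': "\<exists>e>0. ball (\<phi> \<one>) e \<subseteq> \<phi> ` (U \<inter> N)" if "open N" "\<one> \<in> N" for N
  proof -
    have "openin (top_of_set (\<phi> ` U)) (\<phi> ` U \<inter> \<psi> -` (U \<inter> N))"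
      using continuous_openin_preimage_gen[OF cont\<psi>, of "U \<inter> N"] U that by auto
    then have "open (\<phi> ` U \<inter> \<psi> -` (U \<inter> N))" using oU by (simp add: openin_open_eq)
    moreover have "\<phi> \<one> \<in> \<phi> ` U \<inter> \<psi> -` (U \<inter> N)" using eU that by simp
    ultimately obtain e where "e > 0" "ball (\<phi> \<one>) e \<subseteq> \<phi> ` U \<inter> \<psi> -` (U \<inter> N)"
      using open_contains_ball by blast
    moreover have "\<phi> ` U \<inter> \<psi> -` (U \<inter> N) \<subseteq> \<phi> ` (U \<inter> N)" by auto
    ultimately show ?thesis by blast
  qed
  show ?thesis
  proof
    fix z assume z: "z \<noteq> \<one>"
    show "\<exists>N. open N \<and> \<one> \<in> N \<and> z \<notin> N"
    proof (cases "z \<in> U")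
      case True
      then have "\<phi> z \<noteq> \<phi> \<one>" using z eU \<psi>\<phi> by metis
      from nhd[of "- {\<phi> z}"] this obtain N where "open N" "\<one> \<in> N" "\<forall>a\<in>N. \<phi> a \<in> - {\<phi> z}"
        by auto
      then show ?thesis by blast
    qed (use U eU in auto)
  next
    define W where "W n = U \<inter> \<phi> -` ball (\<phi> \<one>) (1 / real (Suc n))" for n
    have "open (W n) \<and> \<one> \<in> W n" for n
      using continuous_openin_preimage_gen[OF cont\<phi>, of "ball (\<phi> \<one>) (1 / real (Suc n))"] U eU
      by (auto simp: W_def openin_open_eq)
    moreover have "\<forall>\<^sub>F n in sequentially. W n \<subseteq> N" if N: "open N" "\<one> \<in> N" for N
    proof -
      obtain e where e: "e > 0" "ball (\<phi> \<one>) e \<subseteq> \<phi> ` (U \<inter> N)" using nhd'[OF N] by blast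
      have "\<forall>\<^sub>F n in sequentially. 1 / real (Suc n) < e"
        using e(1) LIMSEQ_inverse_real_of_nat by (auto dest!: order_tendstoD(2) simp: inverse_eq_divide)
      then show ?thesis
      proof eventually_elim
        case (elim n)
        show ?case
        proof
          fix a assume a: "a \<in> W n"
          with elim have "\<phi> a \<in> ball (\<phi> \<one>) e" by (auto simp: W_def)
          with e(2) obtain b where "b \<in> U" "b \<in> N" "\<phi> a = \<phi> b" by blast
          with a show "a \<in> N" by (metis IntD1 W_def \<psi>\<phi>)
        qed
      qed
    qed
    ultimately show "\<exists>W :: nat \<Rightarrow> 'g set.
        (\<forall>n. open (W n) \<and> \<one> \<in> W n) \<and> (\<forall>N. open N \<longrightarrow> \<one> \<in> N \<longrightarrow> (\<forall>\<^sub>F n in sequentially. W n \<subseteq> N))"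
      by blast
  next
    fix F :: "'g filter"
    assume F: "F \<noteq> bot" and cauchy: "\<And>N. open N \<Longrightarrow> \<one> \<in> N \<Longrightarrow>
      \<exists>P. eventually P F \<and> (\<forall>a b. P a \<longrightarrow> P b \<longrightarrow> inv a \<otimes> b \<in> N)"
    define f where "f = \<phi> \<circ> (\<lambda>(a, b). a \<otimes> b) \<circ> inv_into (U \<times> U) (map_prod \<phi> \<phi>)"
    define S where "S = map_prod \<phi> \<phi> ` ((U \<times> U) \<inter> (\<lambda>(a, b). a \<otimes> b) -` U)"
    have "(U \<times> U, map_prod \<phi> \<phi>) \<in> prod_atlas A A" using UA unfolding prod_atlas_def by blast
    with smooth_mult UA have sm: "smooth_on S f"
      unfolding smooth_map_def f_def S_def by blast
    have inj: "inj_on \<phi> U" by (metis \<psi>\<phi> inj_onI)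
    have inv_prod: "inv_into (U \<times> U) (map_prod \<phi> \<phi>) (\<phi> a, \<phi> b) = (a, b)" if "a \<in> U" "b \<in> U" for a b
    proof -
      have "inj_on (map_prod \<phi> \<phi>) (U \<times> U)" using inj by (rule map_prod_inj_on[OF inj])
      from inv_into_f_f[OF this, of "(a, b)"] that show ?thesis by simp
    qed
    have f: "f (\<phi> a, \<phi> b) = \<phi> (a \<otimes> b)" if "a \<in> U" "b \<in> U" for a b
      using inv_prod[OF that] by (simp add: f_def)
    have "map_prod \<phi> \<phi> (\<one>, \<one>) \<in> S" unfolding S_def by (rule imageI) (use eU in simp)
    then have "(\<phi> \<one>, \<phi> \<one>) \<in> S" by simp
    from smooth_on_locally_lipschitz[OF sm this] obtain d C where d: "d > 0"
      and lip: "\<And>y z. y \<in> ball (\<phi> \<one>, \<phi> \<one>) d \<Longrightarrow> z \<in> ball (\<phi> \<one>, \<phi> \<one>) d \<Longrightarrow> norm (f y - f z) \<le> C * norm (y - z)"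
      by metis
    \<comment> \<open>A closed ball is complete, so a limit formed in it stays in the image of the
      chart, where the inverse chart is continuous.\<close>
    obtain e where e: "e > 0" "cball (\<phi> \<one>) e \<subseteq> \<phi> ` U"
      using oU eU open_contains_cball by blast
    \<comment> \<open>Half of \<open>d\<close>, because the distance in the product is bounded by
      the sum of the distances of the two coordinates.\<close>
    define r where "r = min (d / 2) e"
    have r: "r > 0" "r \<le> d / 2" "r \<le> e" using d e by (auto simp: r_def)
    obtain N where N: "open N" "\<one> \<in> N" "N \<subseteq> U" "\<And>a. a \<in> N \<Longrightarrow> \<phi> a \<in> ball (\<phi> \<one>) r"
      using nhd[of "ball (\<phi> \<one>) r"] r by auto
    have pair: "(u, v) \<in> ball (\<phi> \<one>, \<phi> \<one>) d" if "u \<in> ball (\<phi> \<one>) r" "v \<in> ball (\<phi> \<one>) r" for u v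
    proof -
      have "dist (\<phi> \<one>, \<phi> \<one>) (u, v) \<le> dist (\<phi> \<one>) u + dist (\<phi> \<one>) v"
        unfolding dist_prod_def by (simp add: sqrt_sum_squares_le_sum)
      then show ?thesis using that r by auto
    qed
    \<comment> \<open>Write \<open>b\<close> as \<open>a \<otimes> (inv a \<otimes> b)\<close> and
      \<open>a\<close> as \<open>a \<otimes> \<one>\<close>: only the second factor differs, so the
      Lipschitz bound turns a small left quotient into a small difference in the chart.\<close>
    have lip2: "norm (\<phi> b - \<phi> a) \<le> \<bar>C\<bar> * norm (\<phi> (inv a \<otimes> b) - \<phi> \<one>)" if "a \<in> N" "b \<in> N" "inv a \<otimes> b \<in> N" for a b
    proof -
      have "norm (f (\<phi> a, \<phi> (inv a \<otimes> b)) - f (\<phi> a, \<phi> \<one>)) \<le> C * norm ((\<phi> a, \<phi> (inv a \<otimes> b)) - (\<phi> a, \<phi> \<one>))"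
        using that N r by (intro lip pair) auto
      moreover have "f (\<phi> a, \<phi> (inv a \<otimes> b)) = \<phi> b"
        using f[of a "inv a \<otimes> b"] that N(3) by (simp add: subset_iff)
      moreover have "f (\<phi> a, \<phi> \<one>) = \<phi> a"
        using f[of a \<one>] that N(3) eU by (simp add: subset_iff)
      moreover have "C * norm (\<phi> (inv a \<otimes> b) - \<phi> \<one>) \<le> \<bar>C\<bar> * norm (\<phi> (inv a \<otimes> b) - \<phi> \<one>)"
        by (intro mult_right_mono) auto
      ultimately show ?thesis by (simp add: norm_Pair)
    qed
    obtain P where P: "eventually P F" "\<And>a b. P a \<Longrightarrow> P b \<Longrightarrow> inv a \<otimes> b \<in> N"
      using cauchy[OF N(1,2)] by blast
    \<comment> \<open>Translation by \<open>inv g\<close> moves a Cauchy filter, which may live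
      anywhere in the group, into the chart at \<open>\<one>\<close>; left quotients are invariant
      under it.\<close>
    obtain g where g: "P g" using F P(1) eventually_happens' by blast
    let ?h = "\<lambda>a. \<phi> (inv g \<otimes> a)"
    have "uniform_space_class.complete (cball (\<phi> \<one>) e)" by (simp add: complete_eq_closed)
    moreover have "filtermap ?h F \<le> principal (cball (\<phi> \<one>) e)"
      unfolding le_principal eventually_filtermap using P(1)
    proof eventually_elim
      case (elim a)
      from N(4)[OF P(2)[OF g elim]] r show ?case by auto
    qed
    moreover have "filtermap ?h F \<noteq> bot" using F by (simp add: filtermap_bot_iff)
    moreover have "cauchy_filter (filtermap ?h F)"
      unfolding cauchy_filter_metric
    proof (intro allI impI)
      fix \<epsilon> :: real assume \<epsilon>: "\<epsilon> > 0"
      \<comment> \<open>Adding 1 to the constant avoids division by zero and makes the final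
        estimate strict.\<close>
      define \<delta> where "\<delta> = \<epsilon> / (\<bar>C\<bar> + 1)"
      have \<delta>: "\<delta> > 0" using \<epsilon> by (simp add: \<delta>_def)
      obtain N' where N': "open N'" "\<one> \<in> N'" "\<And>a. a \<in> N' \<Longrightarrow> \<phi> a \<in> ball (\<phi> \<one>) \<delta>"
        using nhd[of "ball (\<phi> \<one>) \<delta>"] \<delta> by auto
      obtain Q where Q: "eventually Q F" "\<And>a b. Q a \<Longrightarrow> Q b \<Longrightarrow> inv a \<otimes> b \<in> N'"
        using cauchy[OF N'(1,2)] by blast
      let ?P = "\<lambda>u. \<exists>a. P a \<and> Q a \<and> u = ?h a"
      have "eventually ?P (filtermap ?h F)"
        unfolding eventually_filtermap using P(1) Q(1) by eventually_elim blast
      moreover have "dist u v < \<epsilon>" if uv: "?P u" "?P v" for u v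
      proof -
        from uv obtain a b where ab: "P a" "Q a" "u = ?h a" "P b" "Q b" "v = ?h b" by blast
        have eq: "inv (inv g \<otimes> a) \<otimes> (inv g \<otimes> b) = inv a \<otimes> b" by (simp add: inv_mult assoc)
        have "norm (v - u) \<le> \<bar>C\<bar> * norm (\<phi> (inv a \<otimes> b) - \<phi> \<one>)"
          using lip2[of "inv g \<otimes> a" "inv g \<otimes> b"] P(2) g ab eq by auto
        also have "\<dots> \<le> \<bar>C\<bar> * \<delta>"
          using N'(3)[OF Q(2)[OF ab(2,5)]] by (intro mult_left_mono) (auto simp: dist_norm norm_minus_commute)
        also have "\<dots> < (\<bar>C\<bar> + 1) * \<delta>" using \<delta> by (simp add: algebra_simps)
        also have "\<dots> = \<epsilon>" by (simp add: \<delta>_def add_pos_nonneg)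
        finally show ?thesis by (simp add: dist_norm norm_minus_commute)
      qed
      ultimately show "\<exists>P. eventually P (filtermap ?h F) \<and> (\<forall>x y. P x \<and> P y \<longrightarrow> dist x y < \<epsilon>)" by blast
    qed
    ultimately obtain c where c: "c \<in> cball (\<phi> \<one>) e" "filtermap ?h F \<le> nhds c"
      unfolding complete_uniform by blast
    then have lim: "(?h \<longlongrightarrow> c) F" by (simp add: filterlim_def)
    have cU: "c \<in> \<phi> ` U" using c e by auto
    have inU: "\<forall>\<^sub>F a in F. inv g \<otimes> a \<in> U" using P(1) by eventually_elim (use N P(2) g in blast)
    have "((\<lambda>a. \<psi> (?h a)) \<longlongrightarrow> \<psi> c) F"
      by (rule continuous_on_tendsto_compose[OF cont\<psi> lim cU]) (use inU in eventually_elim, simp)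
    then have "((\<lambda>a. inv g \<otimes> a) \<longlongrightarrow> \<psi> c) F"
      by (rule Lim_transform_eventually) (use inU in eventually_elim, simp)
    then have "((\<lambda>a. g \<otimes> (inv g \<otimes> a)) \<longlongrightarrow> g \<otimes> \<psi> c) F" by (intro tendsto_mult tendsto_const)
    then have "F \<le> nhds (g \<otimes> \<psi> c)" by (simp add: filterlim_def)
    then show "\<exists>l. F \<le> nhds l" ..
  qed
qed

end

section \<open>One-sided limits along the rationals\<close>

text \<open>The pairs do not overlap but need not be adjacent. \<open>B u v\<close> will mean that
  the increment over \<open>[u, v]\<close> lies outside \<open>W\<close>.\<close>

primrec osc_chain :: "(real \<Rightarrow> real \<Rightarrow> bool) \<Rightarrow> real set \<Rightarrow> nat \<Rightarrow> real \<Rightarrow> bool" where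
  "osc_chain B S 0 a = True"
| "osc_chain B S (Suc p) a = (\<exists>u\<in>S. \<exists>v\<in>S. a \<le> u \<and> u < v \<and> B u v \<and> osc_chain B S p v)"

text \<open>Iterated first passage: the path is watched from \<open>s\<close> until its first jump
  and then afresh from there. With \<open>J s j\<close> read as
  \<open>x s j \<omega> \<notin> N\<close>, successive jumps depend on increments over successive
  time intervals, as independence requires.\<close>

primrec greedy_jumps :: "(real \<Rightarrow> real \<Rightarrow> bool) \<Rightarrow> real set \<Rightarrow> nat \<Rightarrow> real \<Rightarrow> bool" where
  "greedy_jumps J D 0 s = True"
| "greedy_jumps J D (Suc p) s =
    (\<exists>j\<in>D. s < j \<and> J s j \<and> (\<forall>i\<in>D. s < i \<longrightarrow> i < j \<longrightarrow> \<not> J s i) \<and> greedy_jumps J D p j)"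

lemma osc_chain_antimono: "osc_chain B S p a \<Longrightarrow> b \<le> a \<Longrightarrow> osc_chain B S p b"
  by (cases p) (auto intro: order_trans)

lemma osc_chain_subset: "osc_chain B S p a \<Longrightarrow> S \<subseteq> T \<Longrightarrow> osc_chain B T p a"
  by (induction p arbitrary: a) (simp_all, blast)

text \<open>A chain has finitely many points, so one stage of the increasing union contains them
  all.\<close>

lemma osc_chain_incseq:
  assumes "osc_chain B (\<Union>n. D n) p a" "incseq D"
  shows "\<exists>n. osc_chain B (D n) p a"
  using assms(1)
proof (induction p arbitrary: a)
  case (Suc p)
  then obtain u v k l where uv: "u \<in> D k" "v \<in> D l" "a \<le> u" "u < v" "B u v" "osc_chain B (\<Union>n. D n) p v"
    by auto
  then obtain m where m: "osc_chain B (D m) p v" using Suc.IH by blast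
  let ?n = "max m (max k l)"
  have sub: "D m \<subseteq> D ?n" "D k \<subseteq> D ?n" "D l \<subseteq> D ?n" by (rule monoD[OF \<open>incseq D\<close>], simp)+
  have "osc_chain B (D ?n) p v" using osc_chain_subset[OF m sub(1)] .
  moreover have "u \<in> D ?n" "v \<in> D ?n" using uv(1,2) sub(2,3) by blast+
  ultimately have "osc_chain B (D ?n) (Suc p) a" using uv(3-5) by auto
  then show ?case ..
qed simp

text \<open>
  First passage times are needed for independence, but the number of greedy jumps is not monotone in
  \<open>D\<close>, whereas chains of oscillations are and so pass to the limit over finite subsets of \<open>S\<close>.
\<close>

lemma osc_chain_imp_greedy_jumps:
  assumes "finite D"
    and split: "\<And>s u v. s \<in> D \<Longrightarrow> u \<in> D \<Longrightarrow> v \<in> D \<Longrightarrow> s \<le> u \<Longrightarrow> u < v \<Longrightarrow> B u v \<Longrightarrow>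
      (s < u \<and> J s u) \<or> J s v"
    and "s \<in> D" "osc_chain B D p s"
  shows "greedy_jumps J D p s"
  using assms(3,4)
proof (induction p arbitrary: s)
  case (Suc p)
  then obtain u v where uv: "u \<in> D" "v \<in> D" "s \<le> u" "u < v" "B u v" "osc_chain B D p v" by auto
  \<comment> \<open>\<open>K\<close> consists of the candidates for the next jump. It contains
    \<open>u\<close> or \<open>v\<close>, so the greedy jump comes no later than \<open>v\<close>,
    and the remaining chain still lies beyond it.\<close>
  define K where "K = {j \<in> D. s < j \<and> J s j}"
  have K: "finite K" "K \<subseteq> D" using \<open>finite D\<close> by (auto simp: K_def)
  have "u \<in> K \<or> v \<in> K" using split[OF \<open>s \<in> D\<close> uv(1-5)] uv by (auto simp: K_def)
  then have ne: "K \<noteq> {}" and le: "Min K \<le> v"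
    using uv(4) Min_le[OF K(1), of u] Min_le[OF K(1), of v] by auto
  have MK: "Min K \<in> K" using K ne by simp
  have "\<not> J s i" if "i \<in> D" "s < i" "i < Min K" for i
    using that Min_le[OF K(1), of i] unfolding K_def by auto
  moreover have "greedy_jumps J D p (Min K)"
    using Suc.IH[of "Min K"] MK K osc_chain_antimono[OF uv(6) le] by blast
  ultimately show ?case using MK by (auto simp: K_def)
qed simp

text \<open>Otherwise every oscillation found before \<open>t\<close> ends at some
  \<open>v < t\<close>, where the search starts again, and chains of every length result.\<close>

lemma osc_chain_left_small:
  assumes "\<not> osc_chain B S p a" "a < t"
  shows "\<exists>b. a \<le> b \<and> b < t \<and> (\<forall>u\<in>S. \<forall>v\<in>S. b \<le> u \<longrightarrow> u < v \<longrightarrow> v < t \<longrightarrow> \<not> B u v)"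
proof (rule ccontr)
  assume neg: "\<not> ?thesis"
  have "osc_chain B S q b" if "a \<le> b" "b < t" for q b
    using that
  proof (induction q arbitrary: b)
    case (Suc q)
    then obtain u v where "u \<in> S" "v \<in> S" "b \<le> u" "u < v" "v < t" "B u v" using neg by blast
    then show ?case using Suc.IH[of v] Suc.prems by auto
  qed simp
  with assms show False by blast
qed

text \<open>To the right of \<open>t\<close> chains grow at the front: a new pair fits between
  \<open>t\<close> and the start of the chain already found.\<close>

lemma osc_chain_right_small:
  assumes "\<not> osc_chain B S p a" "a \<le> t"
  shows "\<exists>b>t. \<forall>u\<in>S. \<forall>v\<in>S. t < u \<longrightarrow> u < v \<longrightarrow> v < b \<longrightarrow> \<not> B u v"
proof (rule ccontr)
  assume neg: "\<not> ?thesis"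
  have "\<exists>c>t. osc_chain B S q c" for q
  proof (induction q)
    case 0
    show ?case using gt_ex by auto
  next
    case (Suc q)
    then obtain c where c: "c > t" "osc_chain B S q c" by blast
    then obtain u v where uv: "u \<in> S" "v \<in> S" "t < u" "u < v" "v < c" "B u v" using neg by blast
    then have "osc_chain B S q v" using osc_chain_antimono[OF c(2)] by simp
    with uv have "osc_chain B S (Suc q) u" by auto
    with uv show ?case by blast
  qed
  then show False using assms osc_chain_antimono by (metis less_le order_trans)
qed

section \<open>Approximation of times by nonnegative rationals\<close>

abbreviation nonneg_rats :: "real set" where
  "nonneg_rats \<equiv> \<rat> \<inter> {0..}"

lemma nonneg_rat_between:
  assumes "max 0 a < b"
  shows "\<exists>q\<in>nonneg_rats. a < q \<and> q < b"
  using Rats_dense_in_real[OF assms] by auto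

lemma at_right_nonneg_rats_neq_bot:
  assumes "0 \<le> t"
  shows "at t within nonneg_rats \<inter> {t<..} \<noteq> bot"
  unfolding trivial_limit_within islimpt_approachable_real not_not
proof (intro allI impI)
  fix e :: real assume "e > 0"
  with assms have "max 0 t < t + e" by simp
  then obtain q where "q \<in> nonneg_rats" "t < q" "q < t + e" using nonneg_rat_between by blast
  then show "\<exists>x'\<in>nonneg_rats \<inter> {t<..}. x' \<noteq> t \<and> \<bar>x' - t\<bar> < e" by (intro bexI[of _ q]) auto
qed

lemma at_left_nonneg_rats_neq_bot:
  assumes "0 < t"
  shows "at t within nonneg_rats \<inter> {..<t} \<noteq> bot"
  unfolding trivial_limit_within islimpt_approachable_real not_not
proof (intro allI impI)
  fix e :: real assume "e > 0"
  with assms have "max 0 (t - e) < t" by simp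
  then obtain q where "q \<in> nonneg_rats" "t - e < q" "q < t" using nonneg_rat_between by blast
  then show "\<exists>x'\<in>nonneg_rats \<inter> {..<t}. x' \<noteq> t \<and> \<bar>x' - t\<bar> < e" by (intro bexI[of _ q]) auto
qed

section \<open>From one regular path to a cadlag function of two times\<close>

context topological_group
begin

text \<open>The filters \<open>inf (nhds s) (principal P)\<close> are not punctured: within a
  quadrant one coordinate may stay at \<open>s\<close> or \<open>t\<close> while the other
  moves.\<close>

lemma tendsto_ldiv_pair:
  assumes "(f \<longlongrightarrow> a) (inf (nhds s) (principal P))" "(g \<longlongrightarrow> b) (inf (nhds t) (principal R))"
    and "Z \<subseteq> P \<times> R"
  shows "((\<lambda>(s', t'). inv (f s') \<otimes> g t') \<longlongrightarrow> inv a \<otimes> b) (at (s, t) within Z)"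
proof -
  have le: "at (s, t) within Z \<le> nhds s \<times>\<^sub>F nhds t"
    by (simp add: at_within_def nhds_prod[symmetric])
  have ev: "\<forall>\<^sub>F p in at (s, t) within Z. fst p \<in> P" "\<forall>\<^sub>F p in at (s, t) within Z. snd p \<in> R"
    using assms(3) by (auto simp: eventually_at_filter intro!: always_eventually)
  have "filterlim fst (nhds s) (at (s, t) within Z)" "filterlim snd (nhds t) (at (s, t) within Z)"
    by (rule filterlim_mono[OF filterlim_fst order_refl le], rule filterlim_mono[OF filterlim_snd order_refl le])
  with ev have "filterlim fst (inf (nhds s) (principal P)) (at (s, t) within Z)"
      "filterlim snd (inf (nhds t) (principal R)) (at (s, t) within Z)"
    by (auto simp: filterlim_inf filterlim_principal)
  then have "((\<lambda>p. inv (f (fst p)) \<otimes> g (snd p)) \<longlongrightarrow> inv a \<otimes> b) (at (s, t) within Z)"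
    by (intro tendsto_mult tendsto_inv filterlim_compose[OF assms(1)] filterlim_compose[OF assms(2)])
  then show ?thesis by (simp add: case_prod_unfold)
qed

text \<open>The left quotient is continuous in both factors, so one-sided limits of the single path
  \<open>f\<close> give joint limits in every quadrant.\<close>

lemma cadlag_both_ldiv:
  assumes right: "\<And>t. 0 \<le> t \<Longrightarrow> (f \<longlongrightarrow> f t) (at t within {t<..})"
    and left: "\<And>t. 0 < t \<Longrightarrow> \<exists>l. (f \<longlongrightarrow> l) (at t within {0..<t})"
  shows "cadlag_both (\<lambda>s t. inv (f s) \<otimes> f t)"
proof -
  have R: "(f \<longlongrightarrow> f t) (inf (nhds t) (principal {t..}))" if "0 \<le> t" for t
    unfolding tendsto_def eventually_inf_principal
  proof (intro allI impI)
    fix S assume S: "open S" "f t \<in> S"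
    with right[OF that] have "\<forall>\<^sub>F u in at t within {t<..}. f u \<in> S" by (auto dest: topological_tendstoD)
    then show "\<forall>\<^sub>F u in nhds t. u \<in> {t..} \<longrightarrow> f u \<in> S"
      unfolding eventually_at_filter by eventually_elim (use S in force)
  qed
  have L: "\<exists>l. (f \<longlongrightarrow> l) (inf (nhds t) (principal {0..<t}))" if "0 < t" for t
  proof -
    have "at t within {0..<t} = inf (nhds t) (principal {0..<t})"
      by (simp add: at_within_def)
    then show ?thesis using left[OF that] by simp
  qed
  show ?thesis
    unfolding cadlag_both_def
  proof (intro ballI, clarify, intro conjI ballI impI)
    fix s t :: real assume st: "(s, t) \<in> time_simplex"
    then have st': "0 \<le> s" "s \<le> t" "0 \<le> t" by (auto simp: time_simplex_def)
    show "((\<lambda>(s', t'). inv (f s') \<otimes> f t') \<longlongrightarrow> inv (f s) \<otimes> f t) (at (s, t) within time_simplex \<inter> {s..} \<times> {t..})"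
      by (rule tendsto_ldiv_pair[OF R R]) (use st' in auto)
    have ex: "\<exists>P l. (f \<longlongrightarrow> l) (inf (nhds r) (principal P)) \<and> I \<inter> {0..} \<subseteq> P"
      if "I = {r..} \<or> I = {..<r}" "0 \<le> r" for r I
    proof (cases "I = {r..}")
      case True
      then show ?thesis using R[OF that(2)] by blast
    next
      case False
      then have I: "I = {..<r}" using that by blast
      show ?thesis
      proof (cases "r = 0")
        case True
        \<comment> \<open>There is no time to the left of 0: the filter is trivial and
          \<open>\<one>\<close> is an arbitrary choice of limit.\<close>
        then have "(f \<longlongrightarrow> \<one>) (inf (nhds r) (principal {}))" by simp
        with I True show ?thesis by fastforce
      next
        case False
        with L[of r] that(2) obtain l where "(f \<longlongrightarrow> l) (inf (nhds r) (principal {0..<r}))" by auto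
        then show ?thesis using I by fastforce
      qed
    qed
    fix I J assume I: "I \<in> {{s..}, {..<s}}" and J: "J \<in> {{t..}, {..<t}}"
    obtain P a where P: "(f \<longlongrightarrow> a) (inf (nhds s) (principal P))" "I \<inter> {0..} \<subseteq> P"
      using ex[of I s] I st' by blast
    obtain R b where R: "(f \<longlongrightarrow> b) (inf (nhds t) (principal R))" "J \<inter> {0..} \<subseteq> R"
      using ex[of J t] J st' by blast
    have "time_simplex \<inter> I \<times> J \<subseteq> P \<times> R"
      using P(2) R(2) by (auto simp: time_simplex_def)
    from tendsto_ldiv_pair[OF P(1) R(1) this]
    show "\<exists>l. ((\<lambda>(s', t'). inv (f s') \<otimes> f t') \<longlongrightarrow> l) (at (s, t) within time_simplex \<inter> I \<times> J)" ..
  qed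
qed

end

context left_complete_group
begin

text \<open>Oscillations are controlled only for \<open>u < v\<close>. Exchanging the times inverts
  the quotient, which is why \<open>N\<close> is first shrunk to a \<open>V\<close> whose inverses
  also lie in \<open>N\<close>.\<close>

lemma limit_exists:
  fixes g :: "real \<Rightarrow> 'g"
  assumes "F \<noteq> bot"
    and small: "\<And>N. open N \<Longrightarrow> \<one> \<in> N \<Longrightarrow>
      \<exists>P. eventually P F \<and> (\<forall>u v. P u \<longrightarrow> P v \<longrightarrow> u < v \<longrightarrow> inv (g u) \<otimes> g v \<in> N)"
  shows "\<exists>l. (g \<longlongrightarrow> l) F"
proof -
  have "\<exists>l. filtermap g F \<le> nhds l"
  proof (rule left_complete)
    show "filtermap g F \<noteq> bot" using assms(1) by (simp add: filtermap_bot_iff)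
    fix N assume N: "open N" "\<one> \<in> N"
    obtain V where V: "open V" "\<one> \<in> V" "V \<subseteq> N" "\<forall>a\<in>V. inv a \<in> N"
      using nhd_one_inv[OF N] by blast
    obtain P where P: "eventually P F" "\<forall>u v. P u \<longrightarrow> P v \<longrightarrow> u < v \<longrightarrow> inv (g u) \<otimes> g v \<in> V"
      using small[OF V(1,2)] by blast
    have "inv (g u) \<otimes> g v \<in> N" if uv: "P u" "P v" for u v
    proof -
      consider "u < v" | "u = v" | "v < u" by linarith
      then show ?thesis
      proof cases
        case 1
        then show ?thesis using P(2) uv V(3) by blast
      next
        case 2
        then show ?thesis using N by simp
      next
        case 3
        then have "inv (inv (g v) \<otimes> g u) \<in> N" using P(2) uv V(4) by blast
        then show ?thesis by (simp add: inv_mult)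
      qed
    qed
    moreover have "eventually (\<lambda>a. \<exists>u. P u \<and> a = g u) (filtermap g F)"
      unfolding eventually_filtermap using P(1) by eventually_elim blast
    ultimately show "\<exists>P. eventually P (filtermap g F) \<and> (\<forall>a b. P a \<longrightarrow> P b \<longrightarrow> inv a \<otimes> b \<in> N)"
      by blast
  qed
  then show ?thesis by (simp add: filterlim_def)
qed

text \<open>Each \<open>X s\<close> is approximated by \<open>g q\<close> with a rational
  \<open>q\<close> just above \<open>s\<close>, and openness of \<open>T\<close> keeps
  \<open>q\<close> in \<open>T\<close>. Leaving \<open>T\<close> general lets one argument serve
  limits from the left and from the right.\<close>

lemma limit_right_extension:
  fixes g X :: "real \<Rightarrow> 'g"
  assumes X: "\<And>s. 0 \<le> s \<Longrightarrow> (g \<longlongrightarrow> X s) (at s within nonneg_rats \<inter> {s<..})"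
    and "open T" "(g \<longlongrightarrow> l) (at t within nonneg_rats \<inter> T)"
  shows "(X \<longlongrightarrow> l) (at t within {0..} \<inter> T)"
  unfolding tendsto_iff_ldiv
proof (intro allI impI)
  fix N assume N: "open N" "\<one> \<in> N"
  obtain V where V: "open V" "\<one> \<in> V" "\<forall>a\<in>V. \<forall>b\<in>V. a \<otimes> inv b \<in> N"
    using nhd_one_rdiv[OF N] by blast
  have "\<forall>\<^sub>F q in at t within nonneg_rats \<inter> T. inv l \<otimes> g q \<in> V"
    using assms(3) V unfolding tendsto_iff_ldiv by blast
  then obtain K where K: "open K" "t \<in> K"
      "\<And>q. q \<in> K \<Longrightarrow> q \<noteq> t \<Longrightarrow> q \<in> nonneg_rats \<inter> T \<Longrightarrow> inv l \<otimes> g q \<in> V"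
    unfolding eventually_at_topological by blast
  have "inv l \<otimes> X s \<in> N" if s: "s \<in> K" "s \<noteq> t" "s \<in> {0..} \<inter> T" for s
  proof -
    have "0 \<le> s" using s by simp
    have "open (K \<inter> T - {t})" "s \<in> K \<inter> T - {t}" using K \<open>open T\<close> s by auto
    then have "\<forall>\<^sub>F q in at s within nonneg_rats \<inter> {s<..}. q \<in> K \<inter> T - {t}"
      by (auto simp: eventually_at_topological)
    moreover have "\<forall>\<^sub>F q in at s within nonneg_rats \<inter> {s<..}. inv (X s) \<otimes> g q \<in> V"
      using X[OF \<open>0 \<le> s\<close>] V unfolding tendsto_iff_ldiv by blast
    moreover have "\<forall>\<^sub>F q in at s within nonneg_rats \<inter> {s<..}. q \<in> nonneg_rats"
      by (auto simp: eventually_at_filter)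
    ultimately have "\<forall>\<^sub>F q in at s within nonneg_rats \<inter> {s<..}.
        q \<in> K \<inter> T - {t} \<and> inv (X s) \<otimes> g q \<in> V \<and> q \<in> nonneg_rats"
      by eventually_elim auto
    then obtain q where q: "q \<in> K \<inter> T - {t}" "inv (X s) \<otimes> g q \<in> V" "q \<in> nonneg_rats"
      using at_right_nonneg_rats_neq_bot[OF \<open>0 \<le> s\<close>] eventually_happens' by blast
    have "(inv l \<otimes> g q) \<otimes> inv (inv (X s) \<otimes> g q) = inv l \<otimes> X s"
      by (simp add: inv_mult assoc)
    moreover have "inv l \<otimes> g q \<in> V" using K(3) q by blast
    ultimately show ?thesis using V(3) q(2) by metis
  qed
  then show "\<forall>\<^sub>F s in at t within {0..} \<inter> T. inv l \<otimes> X s \<in> N"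
    unfolding eventually_at_topological using K by blast
qed

text \<open>The deterministic part of the construction. \<open>X t\<close> is the right limit even
  at rational \<open>t\<close>, so it may differ from \<open>g t\<close>; their almost sure
  agreement will come from stochastic continuity.\<close>

lemma regular_extension:
  fixes g :: "real \<Rightarrow> 'g"
  assumes left: "\<And>N t. open N \<Longrightarrow> \<one> \<in> N \<Longrightarrow> 0 < t \<Longrightarrow>
      \<exists>b<t. \<forall>u\<in>nonneg_rats. \<forall>v\<in>nonneg_rats. b < u \<longrightarrow> u < v \<longrightarrow> v < t \<longrightarrow> inv (g u) \<otimes> g v \<in> N"
    and right: "\<And>N t. open N \<Longrightarrow> \<one> \<in> N \<Longrightarrow> 0 \<le> t \<Longrightarrow>
      \<exists>b>t. \<forall>u\<in>nonneg_rats. \<forall>v\<in>nonneg_rats. t < u \<longrightarrow> u < v \<longrightarrow> v < b \<longrightarrow> inv (g u) \<otimes> g v \<in> N"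
  shows "\<exists>X. (\<forall>t\<ge>0. (g \<longlongrightarrow> X t) (at t within nonneg_rats \<inter> {t<..})) \<and>
    cadlag_both (\<lambda>s t. inv (X s) \<otimes> X t)"
proof -
  have "\<exists>l. (g \<longlongrightarrow> l) (at t within nonneg_rats \<inter> {t<..})" if t: "0 \<le> t" for t
  proof (rule limit_exists[OF at_right_nonneg_rats_neq_bot[OF t]])
    fix N assume "open N" "\<one> \<in> N"
    from right[OF this t] obtain b where b: "b > t"
      "\<forall>u\<in>nonneg_rats. \<forall>v\<in>nonneg_rats. t < u \<longrightarrow> u < v \<longrightarrow> v < b \<longrightarrow> inv (g u) \<otimes> g v \<in> N" by blast
    have "\<forall>\<^sub>F u in at t within nonneg_rats \<inter> {t<..}. u \<in> nonneg_rats \<and> t < u \<and> u < b"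
      unfolding eventually_at_topological using b(1) by (intro exI[of _ "{..<b}"]) auto
    then show "\<exists>P. eventually P (at t within nonneg_rats \<inter> {t<..}) \<and>
        (\<forall>u v. P u \<longrightarrow> P v \<longrightarrow> u < v \<longrightarrow> inv (g u) \<otimes> g v \<in> N)"
      using b(2) by blast
  qed
  then obtain X where X: "\<And>t. 0 \<le> t \<Longrightarrow> (g \<longlongrightarrow> X t) (at t within nonneg_rats \<inter> {t<..})"
    by metis
  have "cadlag_both (\<lambda>s t. inv (X s) \<otimes> X t)"
  proof (rule cadlag_both_ldiv)
    fix t :: real assume t: "0 \<le> t"
    have "{0..} \<inter> {t<..} = {t<..}" using t by auto
    then show "(X \<longlongrightarrow> X t) (at t within {t<..})"
      using limit_right_extension[OF X open_greaterThan X[OF t]] by simp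
  next
    fix t :: real assume t: "0 < t"
    have "\<exists>l. (g \<longlongrightarrow> l) (at t within nonneg_rats \<inter> {..<t})"
    proof (rule limit_exists[OF at_left_nonneg_rats_neq_bot[OF t]])
      fix N assume "open N" "\<one> \<in> N"
      from left[OF this t] obtain b where b: "b < t"
        "\<forall>u\<in>nonneg_rats. \<forall>v\<in>nonneg_rats. b < u \<longrightarrow> u < v \<longrightarrow> v < t \<longrightarrow> inv (g u) \<otimes> g v \<in> N" by blast
      have "\<forall>\<^sub>F u in at t within nonneg_rats \<inter> {..<t}. u \<in> nonneg_rats \<and> b < u \<and> u < t"
        unfolding eventually_at_topological using b(1) by (intro exI[of _ "{b<..}"]) auto
      then show "\<exists>P. eventually P (at t within nonneg_rats \<inter> {..<t}) \<and>
          (\<forall>u v. P u \<longrightarrow> P v \<longrightarrow> u < v \<longrightarrow> inv (g u) \<otimes> g v \<in> N)"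
        using b(2) by blast
    qed
    then obtain l where "(g \<longlongrightarrow> l) (at t within nonneg_rats \<inter> {..<t})" ..
    from limit_right_extension[OF X open_lessThan this]
    show "\<exists>l. (X \<longlongrightarrow> l) (at t within {0..<t})"
      by (auto simp: atLeastLessThan_def)
  qed
  with X show ?thesis by blast
qed

end

section \<open>Oscillations of multiplicative processes\<close>

text \<open>By completeness both halves of the symmetric difference are null sets. In this form
  measurability passes over in every sub-sigma-algebra that contains the null sets.\<close>

lemma complete_measure_AE_iff:
  assumes "complete_measure M" "AE \<omega> in M. P \<omega> \<longleftrightarrow> Q \<omega>"
  shows "\<exists>N1 N2. N1 \<in> null_sets M \<and> N2 \<in> null_sets M \<and>
    {\<omega> \<in> space M. P \<omega>} = ({\<omega> \<in> space M. Q \<omega>} - N1) \<union> N2"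
proof -
  from assms(2) obtain N where N: "N \<in> null_sets M" "{\<omega> \<in> space M. \<not> (P \<omega> \<longleftrightarrow> Q \<omega>)} \<subseteq> N"
    unfolding eventually_ae_filter by blast
  have null: "B \<in> null_sets M" if "B \<subseteq> N" for B
    using complete_measure.complete[OF assms(1) that N(1)] null_sets_subset[OF N(1) _ that] by blast
  show ?thesis
  proof (intro exI conjI)
    show "{\<omega> \<in> space M. Q \<omega> \<and> \<not> P \<omega>} \<in> null_sets M" "{\<omega> \<in> space M. P \<omega> \<and> \<not> Q \<omega>} \<in> null_sets M"
      using N(2) by (auto intro!: null)
  qed auto
qed

text \<open>The sets need not be measurable: a non-measurable set has measure 0.\<close>

lemma complete_measure_Collect_eq_AE:
  assumes "prob_space M" "complete_measure M" "AE \<omega> in M. P \<omega> \<longleftrightarrow> Q \<omega>"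
  shows "measure M {\<omega> \<in> space M. P \<omega>} = measure M {\<omega> \<in> space M. Q \<omega>}"
proof -
  interpret prob_space M by fact
  have imp: "{\<omega> \<in> space M. P' \<omega>} \<in> events" if "{\<omega> \<in> space M. Q' \<omega>} \<in> events" "AE \<omega> in M. P' \<omega> \<longleftrightarrow> Q' \<omega>" for P' Q'
    using complete_measure_AE_iff[OF assms(2) that(2)] that(1) by (auto simp: null_sets_def)
  have "AE \<omega> in M. Q \<omega> \<longleftrightarrow> P \<omega>" using assms(3) by eventually_elim auto
  then consider "{\<omega> \<in> space M. P \<omega>} \<in> events" "{\<omega> \<in> space M. Q \<omega>} \<in> events"
    | "{\<omega> \<in> space M. P \<omega>} \<notin> events" "{\<omega> \<in> space M. Q \<omega>} \<notin> events"
    using imp assms(3) by blast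
  then show ?thesis
  proof cases
    case 1
    then show ?thesis using assms(3) by (intro finite_measure_eq_AE) auto
  next
    case 2
    then show ?thesis by (simp add: measure_notin_sets)
  qed
qed

text \<open>Used to transfer adaptedness to a modification: preimages change only by null sets, and
  these belong to \<open>N\<close>.\<close>

lemma measurable_cong_AE_complete:
  assumes "complete_measure M" "subalgebra M N" "null_sets M \<subseteq> sets N"
    and "f \<in> N \<rightarrow>\<^sub>M L" "AE \<omega> in M. g \<omega> = f \<omega>" "\<And>\<omega>. \<omega> \<in> space M \<Longrightarrow> g \<omega> \<in> space L"
  shows "g \<in> N \<rightarrow>\<^sub>M L"
proof (rule measurableI)
  have sp: "space N = space M" using assms(2) by (simp add: subalgebra_def)
  show "g \<omega> \<in> space L" if "\<omega> \<in> space N" for \<omega> using that sp assms(6) by simp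
  fix B assume B: "B \<in> sets L"
  have "AE \<omega> in M. g \<omega> \<in> B \<longleftrightarrow> f \<omega> \<in> B" using assms(5) by eventually_elim simp
  from complete_measure_AE_iff[OF assms(1) this] obtain N1 N2
    where N: "N1 \<in> null_sets M" "N2 \<in> null_sets M"
      "{\<omega> \<in> space M. g \<omega> \<in> B} = ({\<omega> \<in> space M. f \<omega> \<in> B} - N1) \<union> N2" by blast
  have "{\<omega> \<in> space M. f \<omega> \<in> B} \<in> sets N"
    using measurable_sets[OF assms(4) B] sp by (simp add: vimage_def Int_def conj_commute)
  then have "{\<omega> \<in> space M. g \<omega> \<in> B} \<in> sets N" using N assms(3) by auto
  then show "g -` B \<inter> space N \<in> sets N"
    using sp by (simp add: vimage_def Int_def conj_commute)
qed

section \<open>Increments of the process and events of the filtration\<close>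

locale multiplicative_process_space = additive_filtration M F + left_complete_group G
  for M :: "'w measure" and F and G :: "('g::topological_space, 'z) monoid_scheme" (structure) +
  fixes x :: "real \<Rightarrow> real \<Rightarrow> 'w \<Rightarrow> 'g"
  assumes complete: "complete_measure M"
    and null: "0 \<le> s \<Longrightarrow> s \<le> t \<Longrightarrow> null_sets M \<subseteq> sets (F s t)"
    and process: "multiplicative_process G M F x"
begin

lemma measurable_x: "0 \<le> s \<Longrightarrow> s \<le> t \<Longrightarrow> x s t \<in> F s t \<rightarrow>\<^sub>M borel"
  and AE_x_refl: "0 \<le> s \<Longrightarrow> AE \<omega> in M. x s s \<omega> = \<one>"
  and AE_x_mult: "0 \<le> s \<Longrightarrow> s \<le> t \<Longrightarrow> t \<le> u \<Longrightarrow> AE \<omega> in M. x s t \<omega> \<otimes> x t u \<omega> = x s u \<omega>"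
  and stoch_cont: "stochastically_continuous G M x"
  using process unfolding multiplicative_process_def by blast+

lemma space_F: "0 \<le> s \<Longrightarrow> s \<le> t \<Longrightarrow> space (F s t) = space M"
  and sets_F: "0 \<le> s \<Longrightarrow> s \<le> t \<Longrightarrow> E \<in> sets (F s t) \<Longrightarrow> E \<in> events"
  using subalg unfolding subalgebra_def by blast+

lemma notin_event:
  assumes "0 \<le> s" "s \<le> t" "open V"
  shows "{\<omega> \<in> space M. x s t \<omega> \<notin> V} \<in> sets (F s t)"
proof -
  have "- V \<in> sets borel" using assms(3) by simp
  from measurable_sets[OF measurable_x[OF assms(1,2)] this] show ?thesis
    using space_F[OF assms(1,2)] by (simp add: vimage_def Int_def conj_commute)
qed

lemma in_event:
  assumes "0 \<le> s" "s \<le> t" "open V"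
  shows "{\<omega> \<in> space M. x s t \<omega> \<in> V} \<in> sets (F s t)"
proof -
  have "V \<in> sets borel" using assms(3) by simp
  from measurable_sets[OF measurable_x[OF assms(1,2)] this] show ?thesis
    using space_F[OF assms(1,2)] by (simp add: vimage_def Int_def conj_commute)
qed

lemma prob_in_eq:
  assumes "0 \<le> s" "s \<le> t" "open V"
  shows "prob {\<omega> \<in> space M. x s t \<omega> \<in> V} = 1 - prob {\<omega> \<in> space M. x s t \<omega> \<notin> V}"
proof -
  have "{\<omega> \<in> space M. x s t \<omega> \<in> V} = space M - {\<omega> \<in> space M. x s t \<omega> \<notin> V}" by auto
  then show ?thesis using prob_compl[OF sets_F[OF assms(1,2) notin_event[OF assms]]] by simp
qed

text \<open>Whether \<open>j\<close> is the first exit time is decided by increments inside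
  \<open>[s, j]\<close>, so the event is independent of everything that happens on
  \<open>[j, b]\<close>. The double negation matches the unfolded form of
  \<open>greedy_jumps\<close>.\<close>

lemma first_passage_event:
  assumes "0 \<le> s" "s \<le> j" "finite D" "open N"
  shows "{\<omega> \<in> space M. x s j \<omega> \<notin> N \<and> (\<forall>i\<in>D. s < i \<longrightarrow> i < j \<longrightarrow> \<not> x s i \<omega> \<notin> N)} \<in> sets (F s j)"
proof -
  have "{\<omega> \<in> space (F s j). \<forall>i\<in>{i\<in>D. s < i \<and> i < j}. x s i \<omega> \<in> N} \<in> sets (F s j)"
  proof (rule sets.sets_Collect_finite_All)
    fix i assume i: "i \<in> {i\<in>D. s < i \<and> i < j}"
    have "{\<omega> \<in> space M. x s i \<omega> \<in> N} \<in> sets (F s i)" using assms i by (intro in_event) auto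
    also have "sets (F s i) \<subseteq> sets (F s j)" using assms i by (intro mono) auto
    finally show "{\<omega> \<in> space (F s j). x s i \<omega> \<in> N} \<in> sets (F s j)" using space_F assms by simp
  qed (use assms in simp)
  then have "{\<omega> \<in> space M. x s j \<omega> \<notin> N} \<inter> {\<omega> \<in> space M. \<forall>i\<in>{i\<in>D. s < i \<and> i < j}. x s i \<omega> \<in> N} \<in> sets (F s j)"
    using notin_event[OF assms(1,2,4)] space_F[OF assms(1,2)] by auto
  also have "{\<omega> \<in> space M. x s j \<omega> \<notin> N} \<inter> {\<omega> \<in> space M. \<forall>i\<in>{i\<in>D. s < i \<and> i < j}. x s i \<omega> \<in> N} =
      {\<omega> \<in> space M. x s j \<omega> \<notin> N \<and> (\<forall>i\<in>D. s < i \<longrightarrow> i < j \<longrightarrow> \<not> x s i \<omega> \<notin> N)}" by auto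
  finally show ?thesis .
qed

text \<open>Ottaviani's inequality, decomposing according to the first passage time.\<close>

lemma sum_first_passage_le_half:
  assumes "0 \<le> s" "s \<le> b" "finite D" "\<And>j. j \<in> D \<Longrightarrow> j \<le> b"
    and N: "open N" "open V" "\<forall>a\<in>V. \<forall>b\<in>V. a \<otimes> inv b \<in> N"
    and small: "\<And>j. j \<in> insert s D \<Longrightarrow> s \<le> j \<Longrightarrow> prob {\<omega> \<in> space M. x j b \<omega> \<notin> V} \<le> 1 / 3"
  shows "(\<Sum>j\<in>{j\<in>D. s < j}. prob {\<omega> \<in> space M. x s j \<omega> \<notin> N \<and>
    (\<forall>i\<in>D. s < i \<longrightarrow> i < j \<longrightarrow> \<not> x s i \<omega> \<notin> N)}) \<le> 1 / 2"
proof -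
  define FP where "FP j = {\<omega> \<in> space M. x s j \<omega> \<notin> N \<and>
    (\<forall>i\<in>D. s < i \<longrightarrow> i < j \<longrightarrow> \<not> x s i \<omega> \<notin> N)}" for j
  define K where "K = {j\<in>D. s < j}"
  define R where "R j = {\<omega> \<in> space M. x j b \<omega> \<in> V}" for j
  have K: "finite K" "\<And>j. j \<in> K \<Longrightarrow> s < j \<and> j \<le> b \<and> j \<in> D" using assms by (auto simp: K_def)
  have FP: "FP j \<in> sets (F s j)" "FP j \<in> events" if "j \<in> K" for j
  proof -
    have j: "s \<le> j" using K(2)[OF that] by simp
    show "FP j \<in> sets (F s j)"
      unfolding FP_def by (rule first_passage_event[OF assms(1) j assms(3) N(1)])
    then show "FP j \<in> events" by (rule sets_F[OF assms(1) j])
  qed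
  have R: "R j \<in> sets (F j b)" "R j \<in> events" "2 / 3 \<le> prob (R j)" if "j \<in> K" for j
  proof -
    have j: "0 \<le> j" "j \<le> b" "s \<le> j" "j \<in> insert s D" using K(2)[OF that] assms(1) by auto
    show "R j \<in> sets (F j b)" unfolding R_def by (rule in_event[OF j(1,2) N(2)])
    then show "R j \<in> events" by (rule sets_F[OF j(1,2)])
    show "2 / 3 \<le> prob (R j)"
      unfolding R_def using prob_in_eq[OF j(1,2) N(2)] small[OF j(4,3)] by simp
  qed
  \<comment> \<open>Each \<open>prob (R j)\<close> is at least 1 - 1/3 = 2/3; dividing the final
    bound 1/3 by this factor gives 1/2.\<close>
  have "(2 / 3) * (\<Sum>j\<in>K. prob (FP j)) = (\<Sum>j\<in>K. prob (FP j) * (2 / 3))"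
    by (simp add: sum_distrib_left mult.commute)
  also have "\<dots> \<le> (\<Sum>j\<in>K. prob (FP j) * prob (R j))"
    using R(3) by (intro sum_mono mult_left_mono) auto
  also have "\<dots> = (\<Sum>j\<in>K. prob (FP j \<inter> R j))"
  proof (rule sum.cong[OF refl])
    fix j assume j: "j \<in> K"
    have "indep_set (sets (F s j)) (sets (F j b))"
      using K(2)[OF j] assms(1) by (intro indep) auto
    from indep_setD[OF this FP(1)[OF j] R(1)[OF j]]
    show "prob (FP j) * prob (R j) = prob (FP j \<inter> R j)" by simp
  qed
  also have "\<dots> = prob (\<Union>j\<in>K. FP j \<inter> R j)"
  proof (rule finite_measure_finite_Union[symmetric])
    show "finite K" by (rule K)
    show "(\<lambda>j. FP j \<inter> R j) ` K \<subseteq> events" using FP R by auto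
    show "disjoint_family_on (\<lambda>j. FP j \<inter> R j) K"
    proof (unfold disjoint_family_on_def, intro ballI impI)
      fix i j assume ij: "i \<in> K" "j \<in> K" "i \<noteq> j"
      then show "(FP i \<inter> R i) \<inter> (FP j \<inter> R j) = {}"
        using K(2)[OF ij(1)] K(2)[OF ij(2)] unfolding FP_def by (cases "i < j") auto
    qed
  qed
  \<comment> \<open>If both \<open>x s b\<close> and \<open>x j b\<close> were in \<open>V\<close>,
    their right quotient \<open>x s j\<close> would be in \<open>N\<close>, contrary to the exit at
    \<open>j\<close>.\<close>
  also have "\<dots> \<le> prob {\<omega> \<in> space M. x s b \<omega> \<notin> V}"
  proof (rule finite_measure_mono_AE)
    have "AE \<omega> in M. \<forall>j\<in>K. x s j \<omega> \<otimes> x j b \<omega> = x s b \<omega>"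
      using K assms(1) by (intro AE_finite_allI AE_x_mult) (auto simp: less_imp_le)
    then show "AE \<omega> in M. \<omega> \<in> (\<Union>j\<in>K. FP j \<inter> R j) \<longrightarrow> \<omega> \<in> {\<omega> \<in> space M. x s b \<omega> \<notin> V}"
    proof eventually_elim
      case (elim \<omega>)
      show ?case
      proof
        assume "\<omega> \<in> (\<Union>j\<in>K. FP j \<inter> R j)"
        then obtain j where j: "j \<in> K" "\<omega> \<in> FP j" "\<omega> \<in> R j" by blast
        have "x s b \<omega> \<notin> V"
        proof
          assume "x s b \<omega> \<in> V"
          then have "x s b \<omega> \<otimes> inv (x j b \<omega>) \<in> N" using N(3) j(3) by (auto simp: R_def)
          moreover have "x s b \<omega> \<otimes> inv (x j b \<omega>) = x s j \<omega>"
            using elim j(1) by (metis UNIV_I assoc carrier_UNIV r_inv r_one)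
          ultimately show False using j(2) by (simp add: FP_def)
        qed
        then show "\<omega> \<in> {\<omega> \<in> space M. x s b \<omega> \<notin> V}" using j(2) by (simp add: FP_def)
      qed
    qed
    show "{\<omega> \<in> space M. x s b \<omega> \<notin> V} \<in> events"
      using sets_F[OF assms(1,2) notin_event[OF assms(1,2) N(2)]] .
  qed
  also have "\<dots> \<le> 1 / 3" using small[of s] by simp
  finally show ?thesis unfolding K_def FP_def by simp
qed

text \<open>Jumps counted from \<open>s\<close> use increments inside \<open>[s, b]\<close> only.
  Applied from a jump time \<open>j\<close>, this puts the later jumps in \<open>F j b\<close>,
  which is independent of \<open>F s j\<close>.\<close>

lemma greedy_jumps_event:
  assumes "0 \<le> s" "s \<le> b" "finite D" "\<And>j. j \<in> D \<Longrightarrow> j \<le> b" "open N"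
  shows "{\<omega> \<in> space M. greedy_jumps (\<lambda>u v. x u v \<omega> \<notin> N) D p s} \<in> sets (F s b)"
  using assms(1,2)
proof (induction p arbitrary: s)
  case 0
  then show ?case using sets.top[of "F s b"] space_F by simp
next
  case (Suc p)
  have "{\<omega> \<in> space (F s b). \<exists>j\<in>{j\<in>D. s < j}. (x s j \<omega> \<notin> N \<and> (\<forall>i\<in>D. s < i \<longrightarrow> i < j \<longrightarrow> \<not> x s i \<omega> \<notin> N)) \<and>
      greedy_jumps (\<lambda>u v. x u v \<omega> \<notin> N) D p j} \<in> sets (F s b)"
  proof (rule sets.sets_Collect_finite_Ex)
    fix j assume j: "j \<in> {j\<in>D. s < j}"
    then have j': "0 \<le> j" "s \<le> j" "j \<le> b" using Suc.prems assms(4) by auto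
    have sub: "sets (F s j) \<subseteq> sets (F s b)" "sets (F j b) \<subseteq> sets (F s b)"
      using j' Suc.prems by (intro mono; simp)+
    have "{\<omega> \<in> space (F s b). x s j \<omega> \<notin> N \<and> (\<forall>i\<in>D. s < i \<longrightarrow> i < j \<longrightarrow> \<not> x s i \<omega> \<notin> N)} \<in> sets (F s b)"
      using first_passage_event[OF Suc.prems(1) j'(2) assms(3,5)] sub(1)
      unfolding space_F[OF Suc.prems] by (rule subsetD[rotated])
    moreover have "{\<omega> \<in> space (F s b). greedy_jumps (\<lambda>u v. x u v \<omega> \<notin> N) D p j} \<in> sets (F s b)"
      using Suc.IH[OF j'(1,3)] sub(2)
      unfolding space_F[OF Suc.prems] by (rule subsetD[rotated])
    ultimately show "{\<omega> \<in> space (F s b). (x s j \<omega> \<notin> N \<and> (\<forall>i\<in>D. s < i \<longrightarrow> i < j \<longrightarrow> \<not> x s i \<omega> \<notin> N)) \<and>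
        greedy_jumps (\<lambda>u v. x u v \<omega> \<notin> N) D p j} \<in> sets (F s b)"
      by (rule sets.sets_Collect_conj[rotated])
  qed (use assms(3) in simp)
  moreover have "{\<omega> \<in> space (F s b). \<exists>j\<in>{j\<in>D. s < j}. (x s j \<omega> \<notin> N \<and> (\<forall>i\<in>D. s < i \<longrightarrow> i < j \<longrightarrow> \<not> x s i \<omega> \<notin> N)) \<and>
      greedy_jumps (\<lambda>u v. x u v \<omega> \<notin> N) D p j} = {\<omega> \<in> space M. greedy_jumps (\<lambda>u v. x u v \<omega> \<notin> N) D (Suc p) s}"
    by (auto simp: space_F[OF Suc.prems])
  ultimately show ?case by simp
qed

text \<open>Decompose by the first jump time \<open>j\<close>. The later jumps are independent of
  the passage to \<open>j\<close>, so the induction hypothesis for the start \<open>j\<close>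
  factors out, and the passage probabilities sum to at most 1/2. The set \<open>Z\<close> carries a
  bound uniform in the start.\<close>

lemma prob_greedy_jumps_le:
  assumes "finite D" "D \<subseteq> Z" "b \<in> Z" "\<And>j. j \<in> D \<Longrightarrow> j \<le> b" "Z \<subseteq> {0..}"
    and N: "open N" "open V" "\<forall>a\<in>V. \<forall>b\<in>V. a \<otimes> inv b \<in> N"
    and small: "\<And>u v. u \<in> Z \<Longrightarrow> v \<in> Z \<Longrightarrow> u \<le> v \<Longrightarrow> prob {\<omega> \<in> space M. x u v \<omega> \<notin> V} \<le> 1 / 3"
    and "s \<in> Z" "s \<le> b"
  shows "prob {\<omega> \<in> space M. greedy_jumps (\<lambda>u v. x u v \<omega> \<notin> N) D p s} \<le> (1 / 2) ^ p"
  using assms(10,11)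
proof (induction p arbitrary: s)
  case (Suc p)
  define FP where "FP j = {\<omega> \<in> space M. x s j \<omega> \<notin> N \<and>
    (\<forall>i\<in>D. s < i \<longrightarrow> i < j \<longrightarrow> \<not> x s i \<omega> \<notin> N)}" for j
  define K where "K = {j\<in>D. s < j}"
  define R where "R j = {\<omega> \<in> space M. greedy_jumps (\<lambda>u v. x u v \<omega> \<notin> N) D p j}" for j
  have s: "0 \<le> s" using Suc.prems(1) assms(5) by auto
  have K: "finite K" "\<And>j. j \<in> K \<Longrightarrow> s < j \<and> j \<le> b \<and> j \<in> D \<and> j \<in> Z" using assms(1,2,4) by (auto simp: K_def)
  have FP: "FP j \<in> sets (F s j)" "FP j \<in> events" if "j \<in> K" for j
  proof -
    have j: "s \<le> j" using K(2)[OF that] by simp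
    show "FP j \<in> sets (F s j)"
      unfolding FP_def by (rule first_passage_event[OF s j assms(1) N(1)])
    then show "FP j \<in> events" by (rule sets_F[OF s j])
  qed
  have R: "R j \<in> sets (F j b)" "R j \<in> events" if "j \<in> K" for j
  proof -
    have j: "0 \<le> j" "j \<le> b" using K(2)[OF that] s by auto
    show "R j \<in> sets (F j b)"
      unfolding R_def by (rule greedy_jumps_event[OF j assms(1,4) N(1)])
    then show "R j \<in> events" by (rule sets_F[OF j])
  qed
  have "{\<omega> \<in> space M. greedy_jumps (\<lambda>u v. x u v \<omega> \<notin> N) D (Suc p) s} = (\<Union>j\<in>K. FP j \<inter> R j)"
    by (auto simp: K_def FP_def R_def)
  then have "prob {\<omega> \<in> space M. greedy_jumps (\<lambda>u v. x u v \<omega> \<notin> N) D (Suc p) s} = prob (\<Union>j\<in>K. FP j \<inter> R j)"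
    by (rule arg_cong)
  also have "\<dots> \<le> (\<Sum>j\<in>K. prob (FP j \<inter> R j))"
    using FP(2) R(2) by (intro finite_measure_subadditive_finite K(1)) blast
  also have "\<dots> = (\<Sum>j\<in>K. prob (FP j) * prob (R j))"
  proof (rule sum.cong[OF refl])
    fix j assume j: "j \<in> K"
    have "indep_set (sets (F s j)) (sets (F j b))"
      using K(2)[OF j] s by (intro indep) auto
    from indep_setD[OF this FP(1)[OF j] R(1)[OF j]]
    show "prob (FP j \<inter> R j) = prob (FP j) * prob (R j)" .
  qed
  also have "\<dots> \<le> (\<Sum>j\<in>K. prob (FP j) * (1 / 2) ^ p)"
    using Suc.IH K(2) by (intro sum_mono mult_left_mono) (auto simp: R_def)
  also have "\<dots> = (\<Sum>j\<in>K. prob (FP j)) * (1 / 2) ^ p" by (simp add: sum_distrib_right)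
  also have "\<dots> \<le> 1 / 2 * (1 / 2) ^ p"
  proof (rule mult_right_mono)
    show "(\<Sum>j\<in>K. prob (FP j)) \<le> 1 / 2"
      unfolding FP_def K_def
    proof (rule sum_first_passage_le_half[OF s Suc.prems(2) assms(1,4) N])
      fix j assume "j \<in> insert s D" "s \<le> j"
      then have "j \<in> Z" "j \<le> b" using assms(2,4) Suc.prems by auto
      then show "prob {\<omega> \<in> space M. x j b \<omega> \<notin> V} \<le> 1 / 3" using assms(3) by (intro small)
    qed
  qed simp
  finally show ?case by simp
qed simp

section \<open>Oscillations over finite and countable sets of times\<close>

lemma osc_chain_event:
  assumes "finite D" "0 \<le> a" "open N"
  shows "{\<omega> \<in> space M. osc_chain (\<lambda>u v. x u v \<omega> \<notin> N) D p a} \<in> events"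
  using assms(2)
proof (induction p arbitrary: a)
  case (Suc p)
  have "{\<omega> \<in> space M. \<exists>u\<in>{u\<in>D. a \<le> u}. \<exists>v\<in>{v\<in>D. u < v}. x u v \<omega> \<notin> N \<and>
      osc_chain (\<lambda>u v. x u v \<omega> \<notin> N) D p v} \<in> events"
  proof (intro sets.sets_Collect_finite_Ex sets.sets_Collect_conj)
    fix u v assume uv: "u \<in> {u\<in>D. a \<le> u}" "v \<in> {v\<in>D. u < v}"
    then have uv': "0 \<le> u" "u \<le> v" using Suc.prems by auto
    show "{\<omega> \<in> space M. x u v \<omega> \<notin> N} \<in> events"
      by (rule sets_F[OF uv' notin_event[OF uv' assms(3)]])
    show "{\<omega> \<in> space M. osc_chain (\<lambda>u v. x u v \<omega> \<notin> N) D p v} \<in> events"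
      using uv' by (intro Suc.IH) auto
  qed (use assms(1) in auto)
  moreover have "{\<omega> \<in> space M. \<exists>u\<in>{u\<in>D. a \<le> u}. \<exists>v\<in>{v\<in>D. u < v}. x u v \<omega> \<notin> N \<and>
      osc_chain (\<lambda>u v. x u v \<omega> \<notin> N) D p v} =
      {\<omega> \<in> space M. osc_chain (\<lambda>u v. x u v \<omega> \<notin> N) D (Suc p) a}" by auto
  ultimately show ?case by simp
qed simp

text \<open>Since \<open>x u v\<close> is the left quotient of \<open>x s u\<close> and
  \<open>x s v\<close>, an oscillation beyond \<open>W\<close> over \<open>[u, v]\<close> forces an
  exit from \<open>N\<close> at \<open>u\<close> or at \<open>v\<close>, seen from any earlier
  \<open>s\<close>. The finitely many identities needed hold together outside one null set.\<close>

lemma prob_osc_chain_finite_le: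
  assumes "finite D" "D \<subseteq> Z" "Z \<subseteq> {0..}" "a \<in> D"
    and W: "\<forall>a\<in>N. \<forall>b\<in>N. inv a \<otimes> b \<in> W" "\<one> \<in> N"
    and N: "open N" "open V" "\<forall>a\<in>V. \<forall>b\<in>V. a \<otimes> inv b \<in> N"
    and small: "\<And>u v. u \<in> Z \<Longrightarrow> v \<in> Z \<Longrightarrow> u \<le> v \<Longrightarrow> prob {\<omega> \<in> space M. x u v \<omega> \<notin> V} \<le> 1 / 3"
  shows "prob {\<omega> \<in> space M. osc_chain (\<lambda>u v. x u v \<omega> \<notin> W) D p a} \<le> (1 / 2) ^ p"
proof -
  \<comment> \<open>Ottaviani's inequality compares every exit with one terminal time, here the last
    point of \<open>D\<close>.\<close>
  define b where "b = Max D"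
  have b: "b \<in> D" "\<And>j. j \<in> D \<Longrightarrow> j \<le> b"
    using Max_in[OF assms(1)] Max_ge[OF assms(1)] assms(4) unfolding b_def by (metis empty_iff)+
  have ab: "0 \<le> a" "a \<le> b" using b assms(2-4) by auto
  have D0: "0 \<le> j" if "j \<in> D" for j using that assms(2,3) by auto
  have "AE \<omega> in M. \<forall>s\<in>D. \<forall>u\<in>{u\<in>D. s \<le> u}. \<forall>v\<in>{v\<in>D. u \<le> v}. x s u \<omega> \<otimes> x u v \<omega> = x s v \<omega>"
    using assms(1) D0 by (intro AE_finite_allI AE_x_mult) auto
  moreover have "AE \<omega> in M. \<forall>s\<in>D. x s s \<omega> = \<one>"
    using assms(1) D0 by (intro AE_finite_allI AE_x_refl) auto
  ultimately have "AE \<omega> in M. \<omega> \<in> {\<omega> \<in> space M. osc_chain (\<lambda>u v. x u v \<omega> \<notin> W) D p a} \<longrightarrow>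
      \<omega> \<in> {\<omega> \<in> space M. greedy_jumps (\<lambda>u v. x u v \<omega> \<notin> N) D p a}"
  proof eventually_elim
    case (elim \<omega>)
    have "greedy_jumps (\<lambda>u v. x u v \<omega> \<notin> N) D p a" if "osc_chain (\<lambda>u v. x u v \<omega> \<notin> W) D p a"
      using assms(1) _ assms(4) that
    proof (rule osc_chain_imp_greedy_jumps)
      fix s u v assume D: "s \<in> D" "u \<in> D" "v \<in> D" and le: "s \<le> u" "u < v" and B: "x u v \<omega> \<notin> W"
      have eq: "x s u \<omega> \<otimes> x u v \<omega> = x s v \<omega>" using elim(1) D le by auto
      have "x s u \<omega> \<notin> N \<or> x s v \<omega> \<notin> N"
      proof (rule ccontr)
        assume "\<not> ?thesis"
        then have "inv (x s u \<omega>) \<otimes> x s v \<omega> \<in> W" using W by blast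
        with B show False unfolding eq[symmetric] by simp
      qed
      \<comment> \<open>At \<open>u = s\<close> the increment is \<open>\<one>\<close>, so the exit
        is at \<open>v\<close>; jumps thus happen strictly after \<open>s\<close>.\<close>
      moreover have "x s u \<omega> \<in> N" if "s = u" using elim(2) D W(2) that by simp
      ultimately show "(s < u \<and> x s u \<omega> \<notin> N) \<or> x s v \<omega> \<notin> N" using le by fastforce
    qed
    then show ?case by blast
  qed
  then have "prob {\<omega> \<in> space M. osc_chain (\<lambda>u v. x u v \<omega> \<notin> W) D p a} \<le>
      prob {\<omega> \<in> space M. greedy_jumps (\<lambda>u v. x u v \<omega> \<notin> N) D p a}"
    using sets_F[OF ab greedy_jumps_event[OF ab assms(1) b(2) N(1)]] by (rule finite_measure_mono_AE)
  also have "\<dots> \<le> (1 / 2) ^ p"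
    by (rule prob_greedy_jumps_le[OF assms(1,2) _ b(2) assms(3) N small _ ab(2)])
      (use b assms(2,4) in auto)
  finally show ?thesis .
qed

text \<open>The bound \<open>(1 / 2) ^ p\<close> is the same for all finite subsets, so continuity
  from below extends it to \<open>S\<close>. Letting \<open>p\<close> grow, the event that chains of
  every length exist has probability 0.\<close>

lemma AE_no_infinite_osc_chain:
  assumes "countable S" "S \<subseteq> Z" "Z \<subseteq> {0..}" "a \<in> S"
    and W: "open W" "\<forall>a\<in>N. \<forall>b\<in>N. inv a \<otimes> b \<in> W" "\<one> \<in> N"
    and N: "open N" "open V" "\<forall>a\<in>V. \<forall>b\<in>V. a \<otimes> inv b \<in> N"
    and small: "\<And>u v. u \<in> Z \<Longrightarrow> v \<in> Z \<Longrightarrow> u \<le> v \<Longrightarrow> prob {\<omega> \<in> space M. x u v \<omega> \<notin> V} \<le> 1 / 3"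
  shows "AE \<omega> in M. \<exists>p. \<not> osc_chain (\<lambda>u v. x u v \<omega> \<notin> W) S p a"
proof -
  \<comment> \<open>The start \<open>a\<close> is put into every stage because greedy jumps are
    counted from a point of the finite set.\<close>
  define D where "D n = insert a (from_nat_into S ` {..n})" for n :: nat
  have a: "0 \<le> a" using assms(2-4) by auto
  have D: "finite (D n)" "a \<in> D n" for n by (auto simp: D_def)
  have DS: "D n \<subseteq> S" for n using assms(4) from_nat_into[of S] by (auto simp: D_def)
  have inc: "incseq D" unfolding D_def by (intro monoI insert_mono image_mono) auto
  have un: "(\<Union>n. D n) = S"
  proof
    show "(\<Union>n. D n) \<subseteq> S" using DS by blast
    show "S \<subseteq> (\<Union>n. D n)"
    proof
      fix s assume "s \<in> S"
      then obtain n where "from_nat_into S n = s" using from_nat_into_surj[OF assms(1)] by blast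
      then show "s \<in> (\<Union>n. D n)" by (auto simp: D_def)
    qed
  qed
  define C where "C n p = {\<omega> \<in> space M. osc_chain (\<lambda>u v. x u v \<omega> \<notin> W) (D n) p a}" for n p
  define H where "H p = {\<omega> \<in> space M. osc_chain (\<lambda>u v. x u v \<omega> \<notin> W) S p a}" for p
  have C: "C n p \<in> events" for n p
    unfolding C_def by (rule osc_chain_event[OF D(1) a W(1)])
  have H: "H p = (\<Union>n. C n p)" for p
  proof
    show "H p \<subseteq> (\<Union>n. C n p)"
    proof
      fix \<omega> assume "\<omega> \<in> H p"
      then have "\<omega> \<in> space M" "osc_chain (\<lambda>u v. x u v \<omega> \<notin> W) (\<Union>n. D n) p a"
        by (auto simp: H_def un)
      with osc_chain_incseq[OF this(2) inc] show "\<omega> \<in> (\<Union>n. C n p)" by (auto simp: C_def)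
    qed
    show "(\<Union>n. C n p) \<subseteq> H p" by (auto simp: C_def H_def intro: osc_chain_subset[OF _ DS])
  qed
  have Hev: "H p \<in> events" for p unfolding H using C by auto
  have incC: "incseq (\<lambda>n. C n p)" for p
    unfolding C_def by (rule monoI) (auto intro: osc_chain_subset[OF _ monoD[OF inc]])
  have HP: "prob (H p) \<le> (1 / 2) ^ p" for p
  proof -
    have "prob (C n p) \<le> (1 / 2) ^ p" for n
      unfolding C_def
      by (rule prob_osc_chain_finite_le[OF D(1) _ assms(3) D(2) W(2,3) N small]) (use DS assms(2) in auto)
    moreover have "(\<lambda>n. prob (C n p)) \<longlonglongrightarrow> prob (H p)"
      unfolding H using C incC by (intro finite_Lim_measure_incseq) auto
    ultimately show ?thesis by (intro LIMSEQ_le_const2) auto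
  qed
  have "prob (\<Inter>p. H p) \<le> (1 / 2) ^ p" for p
    using finite_measure_mono[of "\<Inter>p. H p" "H p"] Hev HP[of p] by fastforce
  moreover have "(\<lambda>p. (1 / 2 :: real) ^ p) \<longlonglongrightarrow> 0" by (rule LIMSEQ_realpow_zero) auto
  ultimately have "prob (\<Inter>p. H p) \<le> 0" by (intro LIMSEQ_le_const) auto
  then have "prob (\<Inter>p. H p) = 0" by (simp add: measure_le_0_iff)
  moreover have "(\<Inter>p. H p) \<in> events" using Hev by auto
  ultimately have "AE \<omega> in M. \<omega> \<notin> (\<Inter>p. H p)"
    by (subst AE_iff_null_sets[symmetric]) (auto simp: null_sets_def emeasure_eq_measure)
  then have "AE \<omega> in M. \<omega> \<in> space M \<and> \<omega> \<notin> (\<Inter>p. H p)" using AE_space by eventually_elim auto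
  then show ?thesis by eventually_elim (auto simp: H_def)
qed

text \<open>Stochastic continuity at the diagonal point \<open>(t, t)\<close>, where the reference
  increment \<open>x t t\<close> is almost surely \<open>\<one>\<close>. Both ends vary, so the
  bound is uniform over all increments near \<open>t\<close>.\<close>

lemma prob_increment_locally_small:
  assumes "0 \<le> t" "open V" "\<one> \<in> V" "0 < \<epsilon>"
  shows "\<exists>\<delta>>0. \<forall>u\<ge>0. \<forall>v\<ge>u. \<bar>u - t\<bar> < \<delta> \<longrightarrow> \<bar>v - t\<bar> < \<delta> \<longrightarrow>
    prob {\<omega> \<in> space M. x u v \<omega> \<notin> V} \<le> \<epsilon>"
proof -
  \<comment> \<open>The event on the left is not known to be measurable; completeness makes the
    measures agree in either case.\<close>
  have eq: "prob {\<omega> \<in> space M. inv (x t t \<omega>) \<otimes> x u v \<omega> \<in> V} = prob {\<omega> \<in> space M. x u v \<omega> \<in> V}" for u v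
  proof (rule complete_measure_Collect_eq_AE[OF prob_space_axioms complete])
    show "AE \<omega> in M. inv (x t t \<omega>) \<otimes> x u v \<omega> \<in> V \<longleftrightarrow> x u v \<omega> \<in> V"
      using AE_x_refl[OF assms(1)] by eventually_elim simp
  qed
  have "((\<lambda>(h, k). prob {\<omega> \<in> space M. x (t + h) (t + k) \<omega> \<in> V}) \<longlongrightarrow> 1)
      (at (0, 0) within {(h, k). 0 \<le> t + h \<and> t + h \<le> t + k})"
    using stoch_cont assms unfolding stochastically_continuous_def eq[symmetric] by blast
  then have "\<forall>\<^sub>F (h, k) in at (0, 0) within {(h, k). 0 \<le> t + h \<and> t + h \<le> t + k}.
      1 - \<epsilon> < prob {\<omega> \<in> space M. x (t + h) (t + k) \<omega> \<in> V}"
    using order_tendstoD(1)[of _ 1 _ "1 - \<epsilon>"] assms(4) by (simp add: case_prod_unfold)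
  then obtain d where d: "d > 0" "\<And>h k. 0 \<le> t + h \<Longrightarrow> t + h \<le> t + k \<Longrightarrow> (h, k) \<noteq> (0, 0) \<Longrightarrow>
      dist (h, k) (0, 0) < d \<Longrightarrow> 1 - \<epsilon> < prob {\<omega> \<in> space M. x (t + h) (t + k) \<omega> \<in> V}"
    unfolding eventually_at by auto
  show ?thesis
  proof (intro exI[of _ "d / 2"] conjI allI impI)
    fix u v :: real assume uv: "0 \<le> u" "u \<le> v" "\<bar>u - t\<bar> < d / 2" "\<bar>v - t\<bar> < d / 2"
    have ev: "{\<omega> \<in> space M. x u v \<omega> \<notin> V} \<in> events"
      by (rule sets_F[OF uv(1,2) notin_event[OF uv(1,2) assms(2)]])
    show "prob {\<omega> \<in> space M. x u v \<omega> \<notin> V} \<le> \<epsilon>"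
    \<comment> \<open>The limit says nothing about the point \<open>(0, 0)\<close> itself; there the
      increment is almost surely \<open>\<one>\<close>.\<close>
    proof (cases "u = t \<and> v = t")
      case True
      have "AE \<omega> in M. \<omega> \<in> {\<omega> \<in> space M. x u v \<omega> \<notin> V} \<longrightarrow> \<omega> \<in> {}"
        using AE_x_refl[OF assms(1)] by eventually_elim (use True assms(3) in simp)
      from finite_measure_mono_AE[OF this] show ?thesis using assms(4) by simp
    next
      case False
      have "dist (u - t, v - t) (0, 0) \<le> \<bar>u - t\<bar> + \<bar>v - t\<bar>"
        unfolding dist_prod_def by (simp add: sqrt_sum_squares_le_sum_abs)
      also have "\<dots> < d" using uv by simp
      finally have "1 - \<epsilon> < prob {\<omega> \<in> space M. x u v \<omega> \<in> V}"
        using d(2)[of "u - t" "v - t"] uv False by auto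
      then show ?thesis using prob_in_eq[OF uv(1,2) assms(2)] by simp
    qed
  qed (use d in simp)
qed

end

section \<open>The cadlag modification\<close>

context multiplicative_process_space
begin

text \<open>The null set must not depend on \<open>t\<close>. It is collected from countably many
  intervals \<open>good\<close> with rational endpoints and from the rational starts inside them;
  each \<open>t\<close> lies in such an interval by stochastic continuity.\<close>

lemma AE_increments_small:
  assumes "open W" "\<one> \<in> W"
  shows "AE \<omega> in M.
    (\<forall>t>0. \<exists>b<t. \<forall>u\<in>nonneg_rats. \<forall>v\<in>nonneg_rats. b < u \<longrightarrow> u < v \<longrightarrow> v < t \<longrightarrow> x u v \<omega> \<in> W) \<and>
    (\<forall>t\<ge>0. \<exists>b>t. \<forall>u\<in>nonneg_rats. \<forall>v\<in>nonneg_rats. t < u \<longrightarrow> u < v \<longrightarrow> v < b \<longrightarrow> x u v \<omega> \<in> W)"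
proof -
  obtain N where N: "open N" "\<one> \<in> N" "\<forall>a\<in>N. \<forall>b\<in>N. inv a \<otimes> b \<in> W"
    using nhd_one_ldiv[OF assms] by blast
  obtain V where V: "open V" "\<one> \<in> V" "\<forall>a\<in>V. \<forall>b\<in>V. a \<otimes> inv b \<in> N"
    using nhd_one_rdiv[OF N(1,2)] by blast
  define Z where "Z c d = {0..} \<inter> {c<..<d}" for c d :: real
  define S where "S c d = nonneg_rats \<inter> {c<..<d}" for c d :: real
  define good where "good = {(c, d). c \<in> \<rat> \<and> d \<in> \<rat> \<and>
    (\<forall>u\<in>Z c d. \<forall>v\<in>Z c d. u \<le> v \<longrightarrow> prob {\<omega> \<in> space M. x u v \<omega> \<notin> V} \<le> 1 / 3)}"
  have ctble: "countable (S c d)" for c d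
    unfolding S_def by (rule countable_subset[OF _ countable_rat]) auto
  have "AE \<omega> in M. \<forall>p\<in>good. \<forall>a\<in>S (fst p) (snd p).
      \<exists>n. \<not> osc_chain (\<lambda>u v. x u v \<omega> \<notin> W) (S (fst p) (snd p)) n a"
  proof (intro AE_ball_countable')
    fix p a assume p: "p \<in> good" "a \<in> S (fst p) (snd p)"
    show "AE \<omega> in M. \<exists>n. \<not> osc_chain (\<lambda>u v. x u v \<omega> \<notin> W) (S (fst p) (snd p)) n a"
      by (rule AE_no_infinite_osc_chain[OF ctble _ _ p(2) assms(1) N(3,2,1) V(1,3), of "Z (fst p) (snd p)"])
        (use p in \<open>auto simp: S_def Z_def good_def\<close>)
  next
    have "countable ((\<rat> :: real set) \<times> (\<rat> :: real set))" by (intro countable_SIGMA countable_rat)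
    then show "countable good" by (rule countable_subset[rotated]) (auto simp: good_def)
  qed (rule ctble)
  then show ?thesis
  proof eventually_elim
    case (elim \<omega>)
    have loc: "\<exists>c d a n. c < t \<and> t < d \<and> a \<in> S c d \<and> a \<le> t \<and> (0 < t \<longrightarrow> a < t) \<and>
        \<not> osc_chain (\<lambda>u v. x u v \<omega> \<notin> W) (S c d) n a" if t: "0 \<le> t" for t
    proof -
      obtain \<delta> where \<delta>: "\<delta> > 0" "\<forall>u\<ge>0. \<forall>v\<ge>u. \<bar>u - t\<bar> < \<delta> \<longrightarrow> \<bar>v - t\<bar> < \<delta> \<longrightarrow>
          prob {\<omega> \<in> space M. x u v \<omega> \<notin> V} \<le> 1 / 3"
        using prob_increment_locally_small[OF t V(1,2), of "1 / 3"] by auto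
      obtain c where c: "c \<in> \<rat>" "t - \<delta> < c" "c < t" using Rats_dense_in_real[of "t - \<delta>" t] \<delta>(1) by auto
      obtain d where d: "d \<in> \<rat>" "t < d" "d < t + \<delta>" using Rats_dense_in_real[of t "t + \<delta>"] \<delta>(1) by auto
      have "(c, d) \<in> good" using c d \<delta>(2) by (auto simp: good_def Z_def abs_less_iff)
      \<comment> \<open>A start strictly before \<open>t\<close> is needed to control the left side;
        at time 0 only the right side matters and 0 itself serves.\<close>
      moreover obtain a where a: "a \<in> S c d" "a \<le> t" "0 < t \<longrightarrow> a < t"
      proof (cases "t = 0")
        case True
        then show ?thesis using that[of 0] c d by (auto simp: S_def)
      next
        case False
        then have "max 0 c < t" using t c by simp
        then obtain q where "q \<in> nonneg_rats" "c < q" "q < t" using nonneg_rat_between by blast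
        then show ?thesis using that[of q] c d by (auto simp: S_def)
      qed
      ultimately obtain n where "\<not> osc_chain (\<lambda>u v. x u v \<omega> \<notin> W) (S c d) n a"
        using elim by fastforce
      with a c d show ?thesis by blast
    qed
    show ?case
    proof (intro conjI allI impI)
      fix t :: real assume t: "0 < t"
      obtain c d a n where l: "c < t" "t < d" "a \<in> S c d" "a < t"
          "\<not> osc_chain (\<lambda>u v. x u v \<omega> \<notin> W) (S c d) n a"
        using loc[of t] t by auto
      obtain b where b: "a \<le> b" "b < t"
          "\<forall>u\<in>S c d. \<forall>v\<in>S c d. b \<le> u \<longrightarrow> u < v \<longrightarrow> v < t \<longrightarrow> \<not> x u v \<omega> \<notin> W"
        using osc_chain_left_small[OF l(5,4)] by blast
      have "x u v \<omega> \<in> W" if "u \<in> nonneg_rats" "v \<in> nonneg_rats" "b < u" "u < v" "v < t" for u v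
        using b(1,3) l that by (auto simp: S_def)
      then show "\<exists>b<t. \<forall>u\<in>nonneg_rats. \<forall>v\<in>nonneg_rats. b < u \<longrightarrow> u < v \<longrightarrow> v < t \<longrightarrow> x u v \<omega> \<in> W"
        using b(2) by blast
    next
      fix t :: real assume t: "0 \<le> t"
      obtain c d a n where l: "c < t" "t < d" "a \<in> S c d" "a \<le> t"
          "\<not> osc_chain (\<lambda>u v. x u v \<omega> \<notin> W) (S c d) n a"
        using loc[OF t] by blast
      obtain b where b: "b > t"
          "\<forall>u\<in>S c d. \<forall>v\<in>S c d. t < u \<longrightarrow> u < v \<longrightarrow> v < b \<longrightarrow> \<not> x u v \<omega> \<notin> W"
        using osc_chain_right_small[OF l(5,4)] by blast
      \<comment> \<open>Capping at \<open>d\<close> keeps both times in the interval where the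
        length of chains is bounded.\<close>
      have "x u v \<omega> \<in> W" if "u \<in> nonneg_rats" "v \<in> nonneg_rats" "t < u" "u < v" "v < min b d" for u v
        using b(2) l that by (auto simp: S_def)
      then show "\<exists>b>t. \<forall>u\<in>nonneg_rats. \<forall>v\<in>nonneg_rats. t < u \<longrightarrow> u < v \<longrightarrow> v < b \<longrightarrow> x u v \<omega> \<in> W"
        using b(1) l(2) by (intro exI[of _ "min b d"]) auto
    qed
  qed
qed

text \<open>Cadlag regularity is asked of the left quotients, the form in which the modification is
  built from \<open>X\<close>.\<close>

definition is_path_extension :: "'w \<Rightarrow> (real \<Rightarrow> 'g) \<Rightarrow> bool" where
  "is_path_extension \<omega> X \<longleftrightarrow>
    (\<forall>t\<ge>0. ((\<lambda>s. x 0 s \<omega>) \<longlongrightarrow> X t) (at t within nonneg_rats \<inter> {t<..})) \<and>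
    cadlag_both (\<lambda>s t. inv (X s) \<otimes> X t)"

text \<open>The countable basis leaves one null set for all neighbourhoods of \<open>\<one>\<close>,
  and the cocycle identity at rational times identifies the left quotients of \<open>x 0\<close>
  with the increments already controlled.\<close>

lemma AE_path_extension: "AE \<omega> in M. \<exists>X. is_path_extension \<omega> X"
proof -
  obtain W :: "nat \<Rightarrow> 'g set" where "(\<forall>n. open (W n) \<and> \<one> \<in> W n) \<and>
      (\<forall>N. open N \<longrightarrow> \<one> \<in> N \<longrightarrow> (\<forall>\<^sub>F n in sequentially. W n \<subseteq> N))"
    using countable_basis ..
  then have W: "\<And>n. open (W n)" "\<And>n. \<one> \<in> W n"
      "\<And>N. open N \<Longrightarrow> \<one> \<in> N \<Longrightarrow> \<forall>\<^sub>F n in sequentially. W n \<subseteq> N" by auto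
  have "AE \<omega> in M. \<forall>n.
    (\<forall>t>0. \<exists>b<t. \<forall>u\<in>nonneg_rats. \<forall>v\<in>nonneg_rats. b < u \<longrightarrow> u < v \<longrightarrow> v < t \<longrightarrow> x u v \<omega> \<in> W n) \<and>
    (\<forall>t\<ge>0. \<exists>b>t. \<forall>u\<in>nonneg_rats. \<forall>v\<in>nonneg_rats. t < u \<longrightarrow> u < v \<longrightarrow> v < b \<longrightarrow> x u v \<omega> \<in> W n)"
    unfolding AE_all_countable using AE_increments_small[OF W(1,2)] by blast
  moreover have "AE \<omega> in M. \<forall>u\<in>nonneg_rats. \<forall>v\<in>{v\<in>nonneg_rats. u \<le> v}. x 0 u \<omega> \<otimes> x u v \<omega> = x 0 v \<omega>"
    by (intro AE_ball_countable' AE_x_mult) (auto intro: countable_subset[OF _ countable_rat])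
  ultimately show ?thesis
  proof eventually_elim
    case (elim \<omega>)
    have inc: "inv (x 0 u \<omega>) \<otimes> x 0 v \<omega> = x u v \<omega>" if "u \<in> nonneg_rats" "v \<in> nonneg_rats" "u < v" for u v
    proof -
      have "x 0 v \<omega> = x 0 u \<omega> \<otimes> x u v \<omega>" using elim(2) that by auto
      then show ?thesis by simp
    qed
    have sub: "\<exists>n. W n \<subseteq> N" if "open N" "\<one> \<in> N" for N
      using eventually_happens'[OF sequentially_bot W(3)[OF that]] .
    have left: "\<exists>b<t. \<forall>u\<in>nonneg_rats. \<forall>v\<in>nonneg_rats. b < u \<longrightarrow> u < v \<longrightarrow> v < t \<longrightarrow>
        inv (x 0 u \<omega>) \<otimes> x 0 v \<omega> \<in> N" if N: "open N" "\<one> \<in> N" and t: "0 < t" for N t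
    proof -
      obtain n where n: "W n \<subseteq> N" using sub[OF N] ..
      obtain b where b: "b < t"
          "\<forall>u\<in>nonneg_rats. \<forall>v\<in>nonneg_rats. b < u \<longrightarrow> u < v \<longrightarrow> v < t \<longrightarrow> x u v \<omega> \<in> W n"
        using elim(1) t by blast
      have "inv (x 0 u \<omega>) \<otimes> x 0 v \<omega> \<in> N"
        if uv: "u \<in> nonneg_rats" "v \<in> nonneg_rats" "b < u" "u < v" "v < t" for u v
        unfolding inc[OF uv(1,2,4)] using b(2) n uv by blast
      with b(1) show ?thesis by blast
    qed
    have right: "\<exists>b>t. \<forall>u\<in>nonneg_rats. \<forall>v\<in>nonneg_rats. t < u \<longrightarrow> u < v \<longrightarrow> v < b \<longrightarrow>
        inv (x 0 u \<omega>) \<otimes> x 0 v \<omega> \<in> N" if N: "open N" "\<one> \<in> N" and t: "0 \<le> t" for N t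
    proof -
      obtain n where n: "W n \<subseteq> N" using sub[OF N] ..
      obtain b where b: "b > t"
          "\<forall>u\<in>nonneg_rats. \<forall>v\<in>nonneg_rats. t < u \<longrightarrow> u < v \<longrightarrow> v < b \<longrightarrow> x u v \<omega> \<in> W n"
        using elim(1) t by blast
      have "inv (x 0 u \<omega>) \<otimes> x 0 v \<omega> \<in> N"
        if uv: "u \<in> nonneg_rats" "v \<in> nonneg_rats" "t < u" "u < v" "v < b" for u v
        unfolding inc[OF uv(1,2,4)] using b(2) n uv by blast
      with b(1) show ?thesis by blast
    qed
    show ?case
      unfolding is_path_extension_def
      by (rule regular_extension[of "\<lambda>s. x 0 s \<omega>", OF left right])
  qed
qed

text \<open>Borel--Cantelli along rational times decreasing to \<open>t\<close> sufficiently fast.\<close>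

lemma AE_path_extension_eq:
  assumes t: "0 \<le> t"
  shows "AE \<omega> in M. \<forall>X. is_path_extension \<omega> X \<longrightarrow> X t = x 0 t \<omega>"
proof -
  obtain W :: "nat \<Rightarrow> 'g set" where "(\<forall>n. open (W n) \<and> \<one> \<in> W n) \<and>
      (\<forall>N. open N \<longrightarrow> \<one> \<in> N \<longrightarrow> (\<forall>\<^sub>F n in sequentially. W n \<subseteq> N))"
    using countable_basis ..
  then have W: "\<And>n. open (W n)" "\<And>n. \<one> \<in> W n"
      "\<And>N. open N \<Longrightarrow> \<one> \<in> N \<Longrightarrow> \<forall>\<^sub>F n in sequentially. W n \<subseteq> N" by auto
  \<comment> \<open>The sets \<open>W n\<close> end up inside every neighbourhood of
    \<open>\<one>\<close> and the bounds are summable, so almost surely \<open>x t (q n)\<close>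
    tends to \<open>\<one>\<close>.\<close>
  have "\<exists>q. q \<in> nonneg_rats \<and> t < q \<and> q < t + 1 / real (Suc n) \<and>
      prob {\<omega> \<in> space M. x t q \<omega> \<notin> W n} \<le> (1 / 2) ^ n" for n
  proof -
    obtain \<delta> where \<delta>: "\<delta> > 0" "\<forall>u\<ge>0. \<forall>v\<ge>u. \<bar>u - t\<bar> < \<delta> \<longrightarrow> \<bar>v - t\<bar> < \<delta> \<longrightarrow>
        prob {\<omega> \<in> space M. x u v \<omega> \<notin> W n} \<le> (1 / 2) ^ n"
      using prob_increment_locally_small[OF t W(1,2), of "(1 / 2) ^ n" n] by auto
    have "max 0 t < t + min \<delta> (1 / real (Suc n))" using t \<delta>(1) by simp
    then obtain q where q: "q \<in> nonneg_rats" "t < q" "q < t + min \<delta> (1 / real (Suc n))"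
      using nonneg_rat_between by blast
    then have "prob {\<omega> \<in> space M. x t q \<omega> \<notin> W n} \<le> (1 / 2) ^ n"
      using \<delta>(2)[rule_format, of t q] t \<delta>(1) by auto
    with q show ?thesis by auto
  qed
  then have "\<exists>q. \<forall>n. q n \<in> nonneg_rats \<and> t < q n \<and> q n < t + 1 / real (Suc n) \<and>
      prob {\<omega> \<in> space M. x t (q n) \<omega> \<notin> W n} \<le> (1 / 2) ^ n"
    by (intro choice allI)
  then obtain q where "\<forall>n. q n \<in> nonneg_rats \<and> t < q n \<and> q n < t + 1 / real (Suc n) \<and>
      prob {\<omega> \<in> space M. x t (q n) \<omega> \<notin> W n} \<le> (1 / 2) ^ n" ..
  then have q: "\<And>n. q n \<in> nonneg_rats" "\<And>n. t < q n" "\<And>n. q n < t + 1 / real (Suc n)"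
      "\<And>n. prob {\<omega> \<in> space M. x t (q n) \<omega> \<notin> W n} \<le> (1 / 2) ^ n"
    by blast+
  have "(\<lambda>n. 1 / real (Suc n)) \<longlonglongrightarrow> 0"
    using LIMSEQ_inverse_real_of_nat by (simp add: inverse_eq_divide)
  from tendsto_add[OF tendsto_const[of t] this] have "(\<lambda>n. t + 1 / real (Suc n)) \<longlonglongrightarrow> t" by simp
  then have "q \<longlonglongrightarrow> t"
    by (rule tendsto_sandwich[OF always_eventually[OF allI[OF less_imp_le[OF q(2)]]]
          always_eventually[OF allI[OF less_imp_le[OF q(3)]]] tendsto_const])
  moreover have "q n \<in> nonneg_rats \<inter> {t<..} \<and> q n \<noteq> t" for n using q(1,2)[of n] by auto
  ultimately have lim: "filterlim q (at t within nonneg_rats \<inter> {t<..}) sequentially"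
    unfolding filterlim_at by simp
  have "AE \<omega> in M. \<forall>\<^sub>F n in sequentially. \<omega> \<in> space M - {\<omega> \<in> space M. x t (q n) \<omega> \<notin> W n}"
  proof (rule borel_cantelli_AE1)
    show "{\<omega> \<in> space M. x t (q n) \<omega> \<notin> W n} \<in> events" for n
      using sets_F[OF t _ notin_event[OF t _ W(1)]] q(2)[of n] by simp
    show "emeasure M {\<omega> \<in> space M. x t (q n) \<omega> \<notin> W n} < \<infinity>" for n
      by (simp add: emeasure_eq_measure)
    show "summable (\<lambda>n. prob {\<omega> \<in> space M. x t (q n) \<omega> \<notin> W n})"
      by (rule summable_comparison_test'[OF summable_geometric[of "1 / 2 :: real"]]) (use q(4) in auto)
  qed
  moreover have "AE \<omega> in M. \<forall>n. x 0 t \<omega> \<otimes> x t (q n) \<omega> = x 0 (q n) \<omega>"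
    unfolding AE_all_countable using t q(2) by (auto intro!: AE_x_mult less_imp_le)
  ultimately show ?thesis
  proof eventually_elim
    case (elim \<omega>)
    have "(\<lambda>n. x 0 (q n) \<omega>) \<longlonglongrightarrow> x 0 t \<omega>"
      unfolding tendsto_iff_ldiv
    proof (intro allI impI)
      fix N assume "open N" "\<one> \<in> N"
      then have "\<forall>\<^sub>F n in sequentially. W n \<subseteq> N" by (rule W(3))
      with elim(1) show "\<forall>\<^sub>F n in sequentially. inv (x 0 t \<omega>) \<otimes> x 0 (q n) \<omega> \<in> N"
        by eventually_elim (auto simp: elim(2)[rule_format, symmetric])
    qed
    moreover have "(\<lambda>n. x 0 (q n) \<omega>) \<longlonglongrightarrow> X t" if "is_path_extension \<omega> X" for X
      using that t lim unfolding is_path_extension_def by (auto intro: filterlim_compose)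
    \<comment> \<open>Along \<open>q\<close> the path tends both to \<open>x 0 t \<omega>\<close>
      and to the right limit \<open>X t\<close>.\<close>
    ultimately show ?case using limit_unique[OF sequentially_bot] by blast
  qed
qed

text \<open>The identities for \<open>y\<close> are purely algebraic, hence valid for every
  \<open>\<omega>\<close>. Adaptedness and stochastic continuity are inherited from \<open>x\<close>
  through almost sure equality, by completeness.\<close>

lemma exists_cadlag_modification:
  "\<exists>y. modification M y x \<and>
     (\<forall>\<omega>\<in>space M. cadlag_both (\<lambda>s t. y s t \<omega>)) \<and>
     multiplicative_process G M F y \<and>
     (\<forall>\<omega>\<in>space M. \<forall>s t u. 0 \<le> s \<longrightarrow> s \<le> t \<longrightarrow> t \<le> u \<longrightarrow>
        y s s \<omega> = \<one> \<and> y s u \<omega> = y s t \<omega> \<otimes> y t u \<omega>)"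
proof -
  \<comment> \<open>The choice need not be measurable, since each value is almost surely
    \<open>x 0 t \<omega>\<close>. On the exceptional set the constant path \<open>\<one>\<close>
    has constant quotients and is therefore harmless.\<close>
  define X where "X \<omega> = (if \<exists>X. is_path_extension \<omega> X then SOME X. is_path_extension \<omega> X else (\<lambda>_. \<one>))" for \<omega>
  define y where "y s t \<omega> = inv (X \<omega> s) \<otimes> X \<omega> t" for s t \<omega>
  have X: "is_path_extension \<omega> (X \<omega>)" if "\<exists>X. is_path_extension \<omega> X" for \<omega>
    using that someI_ex[OF that] by (simp add: X_def)
  have AE_X: "AE \<omega> in M. X \<omega> t = x 0 t \<omega>" if "0 \<le> t" for t
    using AE_path_extension AE_path_extension_eq[OF that] by eventually_elim (use X in blast)
  have AE_y: "AE \<omega> in M. y s t \<omega> = x s t \<omega>" if st: "0 \<le> s" "s \<le> t" for s t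
    using AE_X[OF st(1)] AE_X[OF order_trans[OF st]] AE_x_mult[OF order_refl st]
  proof eventually_elim
    case (elim \<omega>)
    then show ?case unfolding y_def by (metis m_cancel(1))
  qed
  have y_refl: "y s s \<omega> = \<one>" and y_mult: "y s t \<omega> \<otimes> y t u \<omega> = y s u \<omega>" for s t u \<omega>
    by (simp_all add: y_def assoc)
  have "cadlag_both (\<lambda>s t. y s t \<omega>)" for \<omega>
  proof (cases "\<exists>X. is_path_extension \<omega> X")
    case True
    from X[OF this] show ?thesis by (simp add: is_path_extension_def y_def)
  next
    case False
    have "cadlag_both (\<lambda>s t :: real. inv \<one> \<otimes> \<one>)"
      by (rule cadlag_both_ldiv[of "\<lambda>_. \<one>"]) auto
    with False show ?thesis by (simp add: y_def X_def)
  qed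
  moreover have "modification M y x"
    unfolding modification_def using AE_y by blast
  moreover have "multiplicative_process G M F y"
    unfolding multiplicative_process_def
  proof (intro conjI allI impI)
    fix s t :: real assume st: "0 \<le> s" "s \<le> t"
    show "y s t \<in> F s t \<rightarrow>\<^sub>M borel"
      by (rule measurable_cong_AE_complete[OF complete subalg[OF st] null[OF st] measurable_x[OF st] AE_y[OF st]])
        simp
  next
    show "stochastically_continuous G M y"
      unfolding stochastically_continuous_def
    proof (intro allI impI)
      fix s t :: real and U assume st: "0 \<le> s" "s \<le> t" and U: "open U" "\<one> \<in> U"
      let ?S = "{(h, k). 0 \<le> s + h \<and> s + h \<le> t + k}"
      \<comment> \<open>Agreement of \<open>x\<close> and \<open>y\<close> is available only for
        times in the simplex, hence the restriction on \<open>(h, k)\<close>; again the sets are not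
        known to be measurable.\<close>
      have eq: "prob {\<omega> \<in> space M. inv (x s t \<omega>) \<otimes> x (s + h) (t + k) \<omega> \<in> U} =
          prob {\<omega> \<in> space M. inv (y s t \<omega>) \<otimes> y (s + h) (t + k) \<omega> \<in> U}" if "(h, k) \<in> ?S" for h k
      proof (rule complete_measure_Collect_eq_AE[OF prob_space_axioms complete])
        have hk: "0 \<le> s + h" "s + h \<le> t + k" using that by auto
        show "AE \<omega> in M. inv (x s t \<omega>) \<otimes> x (s + h) (t + k) \<omega> \<in> U \<longleftrightarrow>
            inv (y s t \<omega>) \<otimes> y (s + h) (t + k) \<omega> \<in> U"
          using AE_y[OF st] AE_y[OF hk] by eventually_elim simp
      qed
      have "((\<lambda>(h, k). prob {\<omega> \<in> space M. inv (x s t \<omega>) \<otimes> x (s + h) (t + k) \<omega> \<in> U}) \<longlongrightarrow> 1)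
          (at (0, 0) within ?S)"
        using stoch_cont st U unfolding stochastically_continuous_def by blast
      then show "((\<lambda>(h, k). prob {\<omega> \<in> space M. inv (y s t \<omega>) \<otimes> y (s + h) (t + k) \<omega> \<in> U}) \<longlongrightarrow> 1)
          (at (0, 0) within ?S)"
        by (rule Lim_transform_eventually) (use eq in \<open>auto simp: eventually_at_filter intro!: always_eventually\<close>)
    qed
  qed (simp_all add: y_refl y_mult)
  ultimately show ?thesis using y_refl y_mult by metis
qed

end

theorem theorem3p6:
  fixes G :: "('g::topological_space, 'z) monoid_scheme"
    and A :: "('g, 'e::banach) chart set"
    and M :: "'w measure"
    and F :: "real \<Rightarrow> real \<Rightarrow> 'w measure"
    and x :: "real \<Rightarrow> real \<Rightarrow> 'w \<Rightarrow> 'g"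
  assumes "banach_lie_group G A"
    and "separable_space (euclidean :: 'g topology)"
    and "prob_space M"
    and "complete_measure M"
    and "additive_filtration M F"
    and "usual_hypotheses M F"
    and "multiplicative_process G M F x"
  shows "\<exists>y. modification M y x \<and>
           (\<forall>\<omega>\<in>space M. cadlag_both (\<lambda>s t. y s t \<omega>)) \<and>
           multiplicative_process G M F y \<and>
           (\<forall>\<omega>\<in>space M. \<forall>s t u. 0 \<le> s \<longrightarrow> s \<le> t \<longrightarrow> t \<le> u \<longrightarrow>
              y s s \<omega> = \<one>\<^bsub>G\<^esub> \<and> y s u \<omega> = y s t \<omega> \<otimes>\<^bsub>G\<^esub> y t u \<omega>)"
proof -
  interpret multiplicative_process_space M F G x
  proof (rule multiplicative_process_space.intro[OF _ _ multiplicative_process_space_axioms.intro])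
    show "left_complete_group G"
      by (rule banach_lie_group.left_complete_group[OF assms(1)])
    show "null_sets M \<subseteq> sets (F s t)" if "0 \<le> s" "s \<le> t" for s t
      using assms(6) that unfolding usual_hypotheses_def by blast
  qed (rule assms)+
  show ?thesis by (rule exists_cadlag_modification)
qed

end
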